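(* Suppose that a Minimum Restraint Function $U$ exists. Then: (i) the system $\dot z=f(z,\alpha)$ is globally asymptotically controllable to $\mathbf{C}$; (ii) if $U$ is a Minimum Restraint Function with constant $\bar p_0>0$ (that is, $H(x,\bar p_0,p)<0$ holds for all $x\in\mathbf{C}^c$ and all $p\in D^*U(x)$ with some $\bar p_0>0$), then $$\mathcal{V}(x)\le \frac{U(x)}{\bar p_0}\qquad\text{for all } x\in\mathbf{C}^c .$$
   Context: Intervals: $]a,b[$, $[a,b[$, etc. denote open, half-open intervals. Standing assumptions: $n,m$ are positive integers; $A\subset\mathbb{R}^m$ is compact; $\mathbf{C}\subset\mathbb{R}^n$ (the target) is closed with compact boundary $\partial\mathbf{C}$; $\mathbf{C}^c=\mathbb{R}^n\setminus\mathbf{C}$ and $\overline{\mathbf{C}^c}$ is its closure; $f:\mathbf{C}^c\times A\to\mathbb{R}^n$ and $l:\mathbf{C}^c\times A\to\mathbb{R}$ are continuous, and $l(x,a)\ge 0$ for all $(x,a)\in\mathbf{C}^c\times A$. (No Lipschitz or boundedness assumption is made on $f,l$; solutions need not be unique.) Write $\mathbf{d}(x)$ for the Euclidean distance of $x$ from $\mathbf{C}$. Admissible pairs: for $x\in\mathbf{C}^c$, an admissible trajectory-control pair from $x$ is a pair $(z,\alpha):[0,T_z[\to\mathbf{C}^c\times A$, with $T_z\in\,]0,+\infty]$, where $\alpha$ is Borel measurable, $z$ is a Carathéodory solution (locally absolutely continuous, equation satisfied a.e.) of $\dot z(t)=f(z(t),\alpha(t))$, $z(0)=x$, and $\lim_{t\to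 T_z^-}\mathbf{d}(z(t))=0$. Value function: $\mathcal{V}(x)=\inf\int_0^{T_z} l(z(t),\alpha(t))\,dt$, the infimum being over all admissible trajectory-control pairs from $x$. Hamiltonian: $H(x,p_0,p)=\inf_{a\in A}\{p_0\,l(x,a)+\langle p,f(x,a)\rangle\}$ for $x\in\mathbf{C}^c$, $p_0\in\mathbb{R}$, $p\in\mathbb{R}^n$. Limiting gradient: for $\Omega\subset\mathbb{R}^n$ open, $F:\Omega\to\mathbb{R}$ locally Lipschitz and $x\in\Omega$, $D^*F(x)$ is the set of all $w=\lim_k\nabla F(x_k)$, where $x_k\to x$, $x_k\ne x$, and $F$ is differentiable at each $x_k$. For a set $S$, $H(x,p_0,S)<0$ means $H(x,p_0,p)<0$ for all $p\in S$. A continuous $U:\overline{\mathbf{C}^c}\to\mathbb{R}$ is positive definite on $\mathbf{C}^c$ if $U(x)>0$ for all $x\in\mathbf{C}^c$ and $U(x)=0$ for all $x\in\partial\mathbf{C}$; it is proper on $\mathbf{C}^c$ if $U^{-1}(K)$ is compact for every compact $K\subset[0,+\infty[$. A continuous $F:\Omega\to\mathbb{R}$, $\Omega$ open, is locally semiconcave if for every $x\in\Omega$ there are $R>0,\rho>0$ such that $F(z_1)+F(z_2)-2F(\frac{z_1+z_2}{2})\le R|z_1-z_2|^2$ for all $z_1,z_2$ in the ball of center $x$ and radius $\rho$ (contained in $\Omega$). Locally semiconcave functions are locally Lipschitz. Minimum Restraint Function: a continuous $U:\overline{\mathbf{C}^c}\to\mathbb{R}$ that is locally semiconcave, positive definite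 and proper on $\mathbf{C}^c$ and for which there exists $\bar p_0\ge 0$ with $H(x,\bar p_0,D^*U(x))<0$ for all $x\in\mathbf{C}^c$. Class $\mathcal{KL}$: continuous functions $\beta:[0,+\infty[\times[0,+\infty[\to[0,+\infty[$ such that (1) $\beta(0,t)=0$ and $\beta(\cdot,t)$ is strictly increasing and unbounded for each $t\ge0$; (2) $\beta(r,\cdot)$ is (weakly) decreasing for each $r\ge 0$; (3) $\beta(r,t)\to0$ as $t\to+\infty$ for each $r\ge0$. Global asymptotic controllability to $\mathbf{C}$: there is $\beta\in\mathcal{KL}$ such that for each $x\in\mathbf{C}^c$ there exists an admissible trajectory-control pair $(z,\alpha)$ from $x$ with $\mathbf{d}(z(t))\le\beta(\mathbf{d}(x),t)$ for all $t\in[0,+\infty[$, where, if $T_z<+\infty$, $z$ is prolonged by $z(t)=\bar z$ for $t\ge T_z$, with $\bar z\in\partial\mathbf{C}$ an arbitrary fixed point. *)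

theory Defs
  imports "HOL-Analysis.Analysis"
begin

text \<open>
  The system has states in \<open>real ^ 'n\<close>, controls in \<open>real ^ 'm\<close>, target \<open>C\<close> and control set \<open>A\<close>.
  The dynamics \<open>f\<close> and the running cost \<open>l\<close> are total functions on pairs (state, control); all
  definitions below only use their values on \<open>(- C) \<times> A\<close>. The distance from the target is
  \<open>infdist x C\<close>.
\<close>

subsection \<open>Admissible trajectory-control pairs\<close>

text \<open>The interval \<open>[0, T[\<close> for \<open>T\<close> in the extended reals.\<close>

definition time_dom :: "ereal \<Rightarrow> real set" where
  "time_dom T = {t. 0 \<le> t \<and> ereal t < T}"

definition abs_continuous_on :: "real set \<Rightarrow> (real \<Rightarrow> 'a::real_normed_vector) \<Rightarrow> bool" where
  "abs_continuous_on S g \<longleftrightarrow>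
     (\<forall>\<epsilon>>0. \<exists>\<delta>>0. \<forall>(k::nat) (a::nat \<Rightarrow> real) (b::nat \<Rightarrow> real).
        (\<forall>i<k. a i \<le> b i \<and> {a i..b i} \<subseteq> S)
        \<and> disjoint_family_on (\<lambda>i. {a i<..<b i}) {..<k}
        \<and> (\<Sum>i<k. b i - a i) < \<delta>
        \<longrightarrow> (\<Sum>i<k. norm (g (b i) - g (a i))) < \<epsilon>)"

definition locally_abs_continuous_on :: "real set \<Rightarrow> (real \<Rightarrow> 'a::real_normed_vector) \<Rightarrow> bool" where
  "locally_abs_continuous_on I g \<longleftrightarrow> (\<forall>a b. {a..b} \<subseteq> I \<longrightarrow> abs_continuous_on {a..b} g)"

text \<open>
  The final limit is taken along the left neighbourhoods of \<open>T\<close> in the extended reals, so that it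
  reads \<open>t \<rightarrow> T-\<close> for finite \<open>T\<close> and \<open>t \<rightarrow> +\<infinity>\<close> for \<open>T = \<infinity>\<close>.
\<close>

definition admissible ::
  "(real^'n) set \<Rightarrow> (real^'m) set \<Rightarrow> ((real^'n) \<times> (real^'m) \<Rightarrow> real^'n) \<Rightarrow> real^'n
     \<Rightarrow> ereal \<Rightarrow> (real \<Rightarrow> real^'n) \<Rightarrow> (real \<Rightarrow> real^'m) \<Rightarrow> bool" where
  "admissible C A f x T z \<alpha> \<longleftrightarrow>
     0 < T
     \<and> (\<forall>t\<in>time_dom T. z t \<in> - C \<and> \<alpha> t \<in> A)
     \<and> \<alpha> \<in> borel_measurable (restrict_space borel (time_dom T))
     \<and> locally_abs_continuous_on (time_dom T) z
     \<and> (AE t in lborel. t \<in> time_dom T \<longrightarrow>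
           (z has_vector_derivative f (z t, \<alpha> t)) (at t within time_dom T))
     \<and> z 0 = x
     \<and> ((\<lambda>t. infdist (z (real_of_ereal t)) C) \<longlongrightarrow> 0) (at_left T)"

text \<open>
  The cost integrand is nonnegative; the value function takes the value \<open>\<infinity>\<close> when there is no
  admissible pair of finite cost.
\<close>

definition value_function ::
  "(real^'n) set \<Rightarrow> (real^'m) set \<Rightarrow> ((real^'n) \<times> (real^'m) \<Rightarrow> real^'n)
     \<Rightarrow> ((real^'n) \<times> (real^'m) \<Rightarrow> real) \<Rightarrow> real^'n \<Rightarrow> ennreal" where
  "value_function C A f l x =
     (INF (T, z, \<alpha>) \<in> {(T, z, \<alpha>). admissible C A f x T z \<alpha>}.
        (\<integral>\<^sup>+ t\<in>time_dom T. ennreal (l (z t, \<alpha> t)) \<partial>lborel))"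

subsection \<open>Minimum Restraint Functions\<close>

text \<open>The infimum is taken in the extended reals, so it is \<open>\<infinity>\<close> for an empty control set.\<close>

definition hamiltonian ::
  "(real^'m) set \<Rightarrow> ((real^'n) \<times> (real^'m) \<Rightarrow> real^'n) \<Rightarrow> ((real^'n) \<times> (real^'m) \<Rightarrow> real)
     \<Rightarrow> real^'n \<Rightarrow> real \<Rightarrow> real^'n \<Rightarrow> ereal" where
  "hamiltonian A f l x p0 p = (INF a\<in>A. ereal (p0 * l (x, a) + p \<bullet> f (x, a)))"

definition limiting_gradient :: "'a::real_inner set \<Rightarrow> ('a \<Rightarrow> real) \<Rightarrow> 'a \<Rightarrow> 'a set" where
  "limiting_gradient \<Omega> F x =
     {w. \<exists>X g. (\<forall>k::nat. X k \<in> \<Omega> \<and> X k \<noteq> x \<and> GDERIV F (X k) :> g k)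
               \<and> X \<longlonglongrightarrow> x \<and> g \<longlonglongrightarrow> w}"

definition locally_semiconcave :: "'a::real_normed_vector set \<Rightarrow> ('a \<Rightarrow> real) \<Rightarrow> bool" where
  "locally_semiconcave \<Omega> F \<longleftrightarrow>
     continuous_on \<Omega> F
     \<and> (\<forall>x\<in>\<Omega>. \<exists>R>0. \<exists>\<rho>>0. ball x \<rho> \<subseteq> \<Omega>
          \<and> (\<forall>z1\<in>ball x \<rho>. \<forall>z2\<in>ball x \<rho>.
               F z1 + F z2 - 2 * F (midpoint z1 z2) \<le> R * (norm (z1 - z2))\<^sup>2))"

definition positive_definite :: "'a::topological_space set \<Rightarrow> ('a \<Rightarrow> real) \<Rightarrow> bool" where
  "positive_definite C U \<longleftrightarrow> (\<forall>x\<in>- C. 0 < U x) \<and> (\<forall>x\<in>frontier C. U x = 0)"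

definition proper_fun :: "'a::topological_space set \<Rightarrow> ('a \<Rightarrow> real) \<Rightarrow> bool" where
  "proper_fun C U \<longleftrightarrow>
     (\<forall>K. compact K \<and> K \<subseteq> {0..} \<longrightarrow> compact {x \<in> closure (- C). U x \<in> K})"

definition minimum_restraint_function_with ::
  "(real^'n) set \<Rightarrow> (real^'m) set \<Rightarrow> ((real^'n) \<times> (real^'m) \<Rightarrow> real^'n)
     \<Rightarrow> ((real^'n) \<times> (real^'m) \<Rightarrow> real) \<Rightarrow> real \<Rightarrow> (real^'n \<Rightarrow> real) \<Rightarrow> bool" where
  "minimum_restraint_function_with C A f l p0 U \<longleftrightarrow>
     continuous_on (closure (- C)) U
     \<and> locally_semiconcave (- C) U
     \<and> positive_definite C U
     \<and> proper_fun C U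
     \<and> 0 \<le> p0
     \<and> (\<forall>x\<in>- C. \<forall>p\<in>limiting_gradient (- C) U x. hamiltonian A f l x p0 p < 0)"

definition minimum_restraint_function ::
  "(real^'n) set \<Rightarrow> (real^'m) set \<Rightarrow> ((real^'n) \<times> (real^'m) \<Rightarrow> real^'n)
     \<Rightarrow> ((real^'n) \<times> (real^'m) \<Rightarrow> real) \<Rightarrow> (real^'n \<Rightarrow> real) \<Rightarrow> bool" where
  "minimum_restraint_function C A f l U \<longleftrightarrow>
     (\<exists>p0. minimum_restraint_function_with C A f l p0 U)"

subsection \<open>Global asymptotic controllability\<close>

definition class_KL :: "(real \<Rightarrow> real \<Rightarrow> real) \<Rightarrow> bool" where
  "class_KL \<beta> \<longleftrightarrow>
     continuous_on ({0..} \<times> {0..}) (\<lambda>(r, t). \<beta> r t)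
     \<and> (\<forall>r\<ge>0. \<forall>t\<ge>0. 0 \<le> \<beta> r t)
     \<and> (\<forall>t\<ge>0. \<beta> 0 t = 0 \<and> strict_mono_on {0..} (\<lambda>r. \<beta> r t) \<and> (\<forall>M. \<exists>r\<ge>0. M < \<beta> r t))
     \<and> (\<forall>r\<ge>0. antimono_on {0..} (\<beta> r))
     \<and> (\<forall>r\<ge>0. (\<beta> r \<longlongrightarrow> 0) at_top)"

definition prolong :: "ereal \<Rightarrow> (real \<Rightarrow> 'a) \<Rightarrow> 'a \<Rightarrow> real \<Rightarrow> 'a" where
  "prolong T z zbar t = (if ereal t < T then z t else zbar)"

text \<open>
  The point \<open>zbar\<close> is an arbitrary boundary point; it is irrelevant (and unconstrained) for
  \<open>T = \<infinity>\<close>.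
\<close>

definition globally_asymptotically_controllable ::
  "(real^'n) set \<Rightarrow> (real^'m) set \<Rightarrow> ((real^'n) \<times> (real^'m) \<Rightarrow> real^'n) \<Rightarrow> bool" where
  "globally_asymptotically_controllable C A f \<longleftrightarrow>
     (\<exists>\<beta>. class_KL \<beta> \<and>
        (\<forall>x\<in>- C. \<exists>T z \<alpha>. admissible C A f x T z \<alpha> \<and>
           (\<forall>zbar. (T < \<infinity> \<longrightarrow> zbar \<in> frontier C) \<longrightarrow>
              (\<forall>t\<ge>0. infdist (prolong T z zbar t) C \<le> \<beta> (infdist x C) t))))"

end

theory Submission
  imports Defs "HOL-Complex_Analysis.Great_Picard"
begin

text \<open>
  The restraint function \<open>U\<close> acts as a control Lyapunov function that also pays for the running cost.
  If \<open>p\<close> is a proximal supergradient of \<open>U\<close> at \<open>x\<close>, that is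
  \<open>U y \<le> U x + p \<bullet> (y - x) + R |y - x|\<^sup>2\<close> near \<open>x\<close>, and if a control \<open>a\<close> satisfies
  \<open>p0 l (x, a) + p \<bullet> f (x, a) < 0\<close>, then along a short solution with the constant control \<open>a\<close> the
  quantity \<open>U\<close> plus \<open>p0\<close> times the accumulated cost decreases at a positive rate: semiconcavity gives the
  estimate in the right direction without differentiability of \<open>U\<close> at \<open>x\<close>. Such supergradients exist at
  every point and are limits of gradients (\<open>semiconcave_supergradient_approx\<close>), and since the set of
  limiting gradients is closed and locally bounded, the strict inequality for the Hamiltonian holds
  with a locally uniform margin (\<open>uniform_descent_direction\<close>). As \<open>f\<close> is only continuous, the short
  solutions come from Peano's theorem (\<open>peano\<close>).

  By properness the bands \<open>{a \<le> U \<le> b}\<close> with \<open>a > 0\<close> are compact, so on each of them the duration and the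
  decrease rate of the arcs are bounded below (\<open>descent_rate_exists\<close>). Concatenating arcs
  indefinitely gives a trajectory along which \<open>U\<close> tends to \<open>0\<close>, reaching each level within a time that
  depends only on that level and on the initial one, and whose total cost times \<open>p0\<close> is at most the
  total decrease of \<open>U\<close>, hence at most \<open>U x\<close> (\<open>controlled_descent\<close>). The latter is the bound for the value
  function. For the controllability, \<open>U\<close> is compared with the distance from the target by compactness,
  and the uniform stability and attractivity so obtained are converted into a bound of class
  \<open>KL\<close> (\<open>KL_majorant\<close>).
\<close>

section \<open>Semiconcave functions\<close>

text \<open>
  Local semiconcavity provides one such constant on a whole ball, which is what makes the estimates for
  gradients and supergradients below uniform in the point.
\<close>

definition semiconcave_on :: "'a::real_normed_vector set \<Rightarrow> real \<Rightarrow> ('a \<Rightarrow> real) \<Rightarrow> bool" where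
  "semiconcave_on S R F \<longleftrightarrow>
     (\<forall>z1\<in>S. \<forall>z2\<in>S. F z1 + F z2 - 2 * F (midpoint z1 z2) \<le> R * (norm (z1 - z2))\<^sup>2)"

text \<open>
  Midpoint semiconcavity suffices for the one-sided quadratic estimate with a gradient. With
  \<open>\<phi> k\<close> the error of the affine approximation at distance \<open>2\<^sup>-\<^sup>k * |w - y|\<close>, the midpoint inequality
  says \<open>\<phi> k \<le> 2 \<phi> (k + 1) + R |w - y|\<^sup>2 / 4\<^sup>k\<close>. Iterating, the quadratic terms form a geometric
  series with sum \<open>2 R |w - y|\<^sup>2\<close>, and \<open>2\<^sup>k \<phi> k\<close> tends to \<open>0\<close> because \<open>g\<close> is the gradient at \<open>y\<close>.
\<close>

lemma semiconcave_gradient_bound_above: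
  fixes F :: "'a::real_inner \<Rightarrow> real"
  assumes sc: "semiconcave_on S R F" and S: "convex S" and R: "0 \<le> R"
    and g: "GDERIV F y :> g" and y: "y \<in> S" and w: "w \<in> S"
  shows "F w \<le> F y + g \<bullet> (w - y) + 2 * R * (norm (w - y))\<^sup>2"
proof -
  define h where "h = w - y"
  define \<phi> where "\<phi> k = F (y + (1 / 2 ^ k) *\<^sub>R h) - F y - (g \<bullet> h) / 2 ^ k" for k :: nat
  have mem: "y + (1 / 2 ^ k) *\<^sub>R h \<in> S" for k :: nat
  proof -
    have "(1 - 1 / 2 ^ k) *\<^sub>R y + (1 / 2 ^ k) *\<^sub>R w \<in> S"
      using S y w by (intro convexD_alt) (auto simp: field_simps)
    then show ?thesis by (simp add: h_def algebra_simps)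
  qed
  have step: "\<phi> k \<le> 2 * \<phi> (Suc k) + R * (norm h)\<^sup>2 / 4 ^ k" for k
  proof -
    have mid: "midpoint y (y + (1 / 2 ^ k) *\<^sub>R h) = y + (1 / 2 ^ Suc k) *\<^sub>R h"
      by (simp add: midpoint_def algebra_simps scaleR_2[symmetric])
    have "F y + F (y + (1 / 2 ^ k) *\<^sub>R h) - 2 * F (y + (1 / 2 ^ Suc k) *\<^sub>R h)
        \<le> R * (norm (y - (y + (1 / 2 ^ k) *\<^sub>R h)))\<^sup>2"
      using sc y mem[of k] unfolding semiconcave_on_def mid[symmetric] by blast
    moreover have "(norm (y - (y + (1 / 2 ^ k) *\<^sub>R h)))\<^sup>2 = (norm h)\<^sup>2 / 4 ^ k"
      by (simp add: power_divide power2_eq_square power_mult_distrib[symmetric])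
    ultimately show ?thesis by (simp add: \<phi>_def)
  qed
  have telescope: "\<phi> 0 \<le> 2 ^ k * \<phi> k + R * (norm h)\<^sup>2 * (2 - 2 / 2 ^ k)" for k
  proof (induction k)
    case (Suc k)
    have "2 ^ k * \<phi> k \<le> 2 ^ k * (2 * \<phi> (Suc k) + R * (norm h)\<^sup>2 / 4 ^ k)"
      by (intro mult_left_mono step) auto
    also have "\<dots> = 2 ^ Suc k * \<phi> (Suc k) + R * (norm h)\<^sup>2 * (1 / 2 ^ k)"
    proof -
      have "(4::real) ^ k = 2 ^ k * 2 ^ k" by (simp add: power_mult_distrib[symmetric])
      then show ?thesis by (simp add: field_simps)
    qed
    finally have "2 ^ k * \<phi> k \<le> 2 ^ Suc k * \<phi> (Suc k) + R * (norm h)\<^sup>2 * (1 / 2 ^ k)" .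
    moreover have "R * (norm h)\<^sup>2 * (2 - 2 / 2 ^ Suc k)
        = R * (norm h)\<^sup>2 * (2 - 2 / 2 ^ k) + R * (norm h)\<^sup>2 * (1 / 2 ^ k)"
      by (simp add: field_simps)
    ultimately show ?case using Suc by linarith
  qed auto
  have "((\<lambda>t. F (y + t *\<^sub>R h)) has_derivative (\<lambda>t. (t *\<^sub>R h) \<bullet> g)) (at 0)"
    by (rule has_derivative_compose[where f="\<lambda>t. y + t *\<^sub>R h", of "\<lambda>t. t *\<^sub>R h"])
       (use g in \<open>auto intro!: derivative_eq_intros simp: gderiv_def\<close>)
  then have "DERIV (\<lambda>t. F (y + t *\<^sub>R h)) 0 :> g \<bullet> h"
    unfolding has_field_derivative_def
    by (rule has_derivative_eq_rhs) (auto simp: inner_commute)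
  then have "(\<lambda>t. (F (y + t *\<^sub>R h) - F y) / t) \<midarrow>0\<rightarrow> g \<bullet> h"
    unfolding DERIV_def by simp
  moreover have "filterlim (\<lambda>k::nat. 1 / 2 ^ k :: real) (at 0) sequentially"
    unfolding filterlim_at by (auto intro!: LIMSEQ_divide_realpow_zero)
  ultimately have "(\<lambda>k::nat. (F (y + (1 / 2 ^ k) *\<^sub>R h) - F y) / (1 / 2 ^ k)) \<longlonglongrightarrow> g \<bullet> h"
    by (rule filterlim_compose)
  then have "(\<lambda>k::nat. (F (y + (1 / 2 ^ k) *\<^sub>R h) - F y) / (1 / 2 ^ k) - g \<bullet> h) \<longlonglongrightarrow> g \<bullet> h - g \<bullet> h"
    by (intro tendsto_intros)
  moreover have "(F (y + (1 / 2 ^ k) *\<^sub>R h) - F y) / (1 / 2 ^ k) - g \<bullet> h = 2 ^ k * \<phi> k" for k :: nat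
    by (simp add: \<phi>_def field_simps)
  ultimately have lim: "(\<lambda>k. 2 ^ k * \<phi> k + 2 * R * (norm h)\<^sup>2) \<longlonglongrightarrow> 0 + 2 * R * (norm h)\<^sup>2"
    by (intro tendsto_intros) simp
  have "\<phi> 0 \<le> 2 ^ k * \<phi> k + 2 * R * (norm h)\<^sup>2" for k
  proof -
    have "R * (norm h)\<^sup>2 * (2 - 2 / 2 ^ k) \<le> R * (norm h)\<^sup>2 * 2"
      using R by (intro mult_left_mono) auto
    then show ?thesis using telescope[of k] by linarith
  qed
  then have "\<phi> 0 \<le> 2 * R * (norm h)\<^sup>2"
    using LIMSEQ_le_const[OF lim] by auto
  then show ?thesis by (simp add: \<phi>_def h_def)
qed

text \<open>
  A large gradient would make the quadratic upper estimate, applied at the point reached from \<open>y\<close>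
  by a step of length \<open>\<rho> / 4\<close> against the gradient, contradict the lower bound \<open>- B\<close>.
\<close>

lemma semiconcave_gradient_norm_le:
  fixes F :: "'a::real_inner \<Rightarrow> real"
  assumes sc: "semiconcave_on (ball x \<rho>) R F" and R: "0 \<le> R" and \<rho>: "0 < \<rho>"
    and B: "\<And>w. w \<in> ball x \<rho> \<Longrightarrow> \<bar>F w\<bar> \<le> B"
    and g: "GDERIV F y :> g" and y: "y \<in> ball x (\<rho> / 2)"
  shows "norm g \<le> 8 * B / \<rho> + R * \<rho>"
proof (cases "g = 0")
  case True
  have "0 \<le> B" using B[of x] \<rho> by auto
  with True R \<rho> show ?thesis by auto
next
  case False
  define h where "h = - (\<rho> / (4 * norm g)) *\<^sub>R g"
  have nh: "norm h = \<rho> / 4" using False \<rho> by (simp add: h_def)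
  have gh: "g \<bullet> h = - (\<rho> / 4) * norm g"
    using False by (simp add: h_def power2_norm_eq_inner[symmetric] power2_eq_square)
  have yb: "y \<in> ball x \<rho>" using y \<rho> by auto
  have wb: "y + h \<in> ball x \<rho>"
  proof -
    have "dist x (y + h) \<le> dist x y + norm h" by (metis add_diff_cancel_left' dist_commute dist_norm dist_triangle)
    then show ?thesis using y nh \<rho> by auto
  qed
  have "F (y + h) \<le> F y + g \<bullet> h + 2 * R * (norm h)\<^sup>2"
    using semiconcave_gradient_bound_above[OF sc convex_ball R g yb wb] by simp
  then have "(\<rho> / 4) * norm g \<le> 2 * B + R * \<rho>\<^sup>2 / 8"
    using B[OF yb] B[OF wb] by (simp add: gh nh power_divide)
  then have "norm g \<le> (2 * B + R * \<rho>\<^sup>2 / 8) * (4 / \<rho>)"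
    using \<rho> by (simp add: field_simps)
  also have "\<dots> = 8 * B / \<rho> + R * \<rho> / 2" using \<rho> by (simp add: field_simps power2_eq_square)
  also have "\<dots> \<le> 8 * B / \<rho> + R * \<rho>" using R \<rho> by simp
  finally show ?thesis .
qed

text \<open>
  Points of differentiability are found where a paraboloid touches \<open>F\<close> from below. Minimise
  \<open>F w + K |w - x|\<^sup>2\<close> over the ball. For large \<open>K\<close> the minimum is attained at an interior point \<open>y\<close>,
  which is such a point of contact. The midpoint inequality for \<open>y + h\<close> and \<open>y - h\<close>
  turns this lower bound at \<open>y - h\<close> into an upper bound at \<open>y + h\<close>, so that \<open>F\<close> is squeezed between two
  paraboloids with the same gradient.
\<close>

lemma semiconcave_differentiable_dense:
  fixes F :: "'a::euclidean_space \<Rightarrow> real"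
  assumes sc: "semiconcave_on S R F" and S: "cball x e \<subseteq> S" and e: "0 < e"
    and cont: "continuous_on S F" and R: "0 \<le> R"
  obtains y g where "y \<in> ball x e" "GDERIV F y :> g"
proof -
  have contb: "continuous_on (cball x e) F" using cont S by (rule continuous_on_subset)
  obtain B where "\<forall>v\<in>F ` cball x e. norm v \<le> B"
    using compact_imp_bounded[OF compact_continuous_image[OF contb compact_cball]]
    unfolding bounded_iff by blast
  then have B: "\<And>y. y \<in> cball x e \<Longrightarrow> \<bar>F y\<bar> \<le> B" by auto
  have B0: "0 \<le> B" using B[of x] e by auto
  \<comment> \<open>On the sphere of radius \<open>e\<close> the penalty is \<open>2 * B + 1\<close>, which exceeds the oscillation of \<open>F\<close>.\<close>
  define K where "K = (2 * B + 1) / e\<^sup>2"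
  have K0: "0 < K" using B0 e by (auto simp: K_def)
  define \<psi> where "\<psi> y = F y + K * (norm (y - x))\<^sup>2" for y
  have "continuous_on (cball x e) \<psi>" unfolding \<psi>_def by (intro continuous_intros contb)
  then obtain y where y: "y \<in> cball x e" and min: "\<And>w. w \<in> cball x e \<Longrightarrow> \<psi> y \<le> \<psi> w"
    using continuous_attains_inf[of "cball x e" \<psi>] e by auto
  have yb: "y \<in> ball x e"
  proof (rule ccontr)
    assume "y \<notin> ball x e"
    then have "norm (y - x) = e" using y by (simp add: dist_norm norm_minus_commute)
    then have "\<psi> y = F y + (2 * B + 1)" using e by (simp add: \<psi>_def K_def)
    moreover have "\<psi> x = F x" by (simp add: \<psi>_def)
    ultimately show False using min[of x] B[OF y] B[of x] e by auto
  qed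
  define g where "g = - (2 * K) *\<^sub>R (y - x)"
  define d where "d = e - dist x y"
  have d: "0 < d" using yb by (simp add: d_def)
  have inb: "y + h \<in> cball x e" if "norm h < d" for h
    using that norm_triangle_ineq[of "y - x" h]
    by (simp add: d_def dist_norm norm_minus_commute algebra_simps)
  have lower: "F y + g \<bullet> h - K * (norm h)\<^sup>2 \<le> F (y + h)" if "norm h < d" for h
  proof -
    have "(norm (y + h - x))\<^sup>2 = (norm (y - x))\<^sup>2 + 2 * ((y - x) \<bullet> h) + (norm h)\<^sup>2"
      using power2_norm_eq_inner[of "(y - x) + h"]
      by (simp add: power2_norm_eq_inner inner_simps inner_commute algebra_simps)
    then have "K * (norm (y + h - x))\<^sup>2 = K * (norm (y - x))\<^sup>2 - g \<bullet> h + K * (norm h)\<^sup>2"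
      by (simp add: g_def distrib_left)
    then show ?thesis using min[OF inb[OF that]] by (simp add: \<psi>_def)
  qed
  have upper: "F (y + h) \<le> F y + g \<bullet> h + (4 * R + K) * (norm h)\<^sup>2" if "norm h < d" for h
  proof -
    have "F (y + h) + F (y - h) - 2 * F (midpoint (y + h) (y - h)) \<le> R * (norm ((y + h) - (y - h)))\<^sup>2"
    proof -
      have "y + h \<in> S" "y - h \<in> S" using inb[OF that] inb[of "- h"] that S by auto
      then show ?thesis using sc unfolding semiconcave_on_def by blast
    qed
    moreover have "midpoint (y + h) (y - h) = y" by (simp add: midpoint_def scaleR_2[symmetric])
    moreover have "(norm ((y + h) - (y - h)))\<^sup>2 = 4 * (norm h)\<^sup>2"
      by (simp add: scaleR_2[symmetric] power_mult_distrib)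
    ultimately have "F (y + h) + F (y - h) \<le> 2 * F y + 4 * R * (norm h)\<^sup>2" by simp
    then show ?thesis using lower[of "- h"] that by (simp add: algebra_simps)
  qed
  have "((\<lambda>h. norm (F (y + h) - F y - h \<bullet> g) / norm h) \<longlongrightarrow> 0) (at 0)"
  proof (rule tendsto_0_le[where K=1])
    show "((\<lambda>h. (4 * R + K) * norm h) \<longlongrightarrow> 0) (at 0)"
      by (rule tendsto_eq_intros | simp)+
    show "\<forall>\<^sub>F h in at 0. norm (norm (F (y + h) - F y - h \<bullet> g) / norm h) \<le> norm ((4 * R + K) * norm h) * 1"
      unfolding eventually_at
    proof (intro exI[of _ d] conjI ballI impI d)
      fix h :: 'a assume h: "h \<noteq> 0 \<and> dist h 0 < d"
      have K: "K * (norm h)\<^sup>2 \<le> (4 * R + K) * (norm h)\<^sup>2" using R by (intro mult_right_mono) auto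
      have "\<bar>F (y + h) - F y - h \<bullet> g\<bar> \<le> (4 * R + K) * (norm h)\<^sup>2"
      proof -
        have "norm h < d" using h by simp
        from lower[OF this] upper[OF this] K show ?thesis
          unfolding inner_commute[of h g] abs_le_iff by linarith
      qed
      then have "\<bar>F (y + h) - F y - h \<bullet> g\<bar> / norm h \<le> (4 * R + K) * norm h"
        using h by (simp add: field_simps power2_eq_square)
      then show "norm (norm (F (y + h) - F y - h \<bullet> g) / norm h) \<le> norm ((4 * R + K) * norm h) * 1"
        using R K0 by (simp add: abs_mult)
    qed
  qed
  then have "GDERIV F y :> g"
    unfolding gderiv_def has_derivative_at by (auto intro: bounded_linear_inner_left)
  with yb that show ?thesis by blast
qed

text \<open>
  Every point \<open>x\<close> has a proximal supergradient \<open>p\<close>, a limit of gradients at points tending to \<open>x\<close>.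
  The approximating points are kept different from the centre \<open>x0\<close>: as \<open>x\<close> varies towards \<open>x0\<close>, a
  diagonal choice of them then yields elements of the limiting gradient at \<open>x0\<close>, whose definition
  excludes \<open>x0\<close> itself.
\<close>

lemma semiconcave_supergradient_approx:
  fixes F :: "'a::euclidean_space \<Rightarrow> real"
  assumes sc: "semiconcave_on (ball x0 \<rho>) R F" and R: "0 \<le> R"
    and cont: "continuous_on (ball x0 \<rho>) F" and bdd: "\<And>w. w \<in> ball x0 \<rho> \<Longrightarrow> \<bar>F w\<bar> \<le> B"
    and x: "x \<in> ball x0 (\<rho> / 2)" and e: "0 < e"
  obtains p y g where "\<And>w. w \<in> ball x0 \<rho> \<Longrightarrow> F w \<le> F x + p \<bullet> (w - x) + 2 * R * (norm (w - x))\<^sup>2"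
    "dist y x < e" "y \<in> ball x0 \<rho>" "y \<noteq> x0" "GDERIV F y :> g" "norm g \<le> 8 * B / \<rho> + R * \<rho>" "norm (g - p) < e"
proof -
  have \<rho>: "0 < \<rho>" using x by (metis ball_eq_empty empty_iff half_gt_zero_iff linorder_not_less)
  have "\<exists>y g. dist y x < 1 / Suc k \<and> y \<in> ball x0 (\<rho> / 2) \<and> y \<noteq> x0 \<and> GDERIV F y :> g" for k :: nat
  proof -
    define r where "r = min (1 / Suc k) (\<rho> / 2 - dist x0 x)"
    have r: "0 < r" using x by (simp add: r_def)
    \<comment> \<open>A centre \<open>x'\<close> other than \<open>x0\<close> leaves room for a ball around \<open>x'\<close> that misses \<open>x0\<close>.\<close>
    obtain x' where x': "dist x x' < r / 2" "x' \<noteq> x0"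
    proof (cases "x = x0")
      case True
      obtain v :: 'a where v: "norm v = r / 4" using vector_choose_size[of "r / 4"] r by auto
      show thesis by (rule that[of "x + v"]) (use True v r in \<open>auto simp: dist_norm\<close>)
    next
      case False then show thesis using that[of x] r by auto
    qed
    define s where "s = min (r / 4) (dist x' x0 / 2)"
    have s: "0 < s" using r x' by (auto simp: s_def)
    have rr: "r \<le> \<rho> / 2 - dist x0 x" "r \<le> 1 / Suc k" by (auto simp: r_def)
    have sub: "cball x' s \<subseteq> ball x0 \<rho>"
    proof
      fix w assume "w \<in> cball x' s"
      moreover have "dist x0 w \<le> dist x0 x + dist x x' + dist x' w"
        using dist_triangle[of x0 w x] dist_triangle[of x w x'] by linarith
      ultimately have "dist x0 w < dist x0 x + r / 2 + r / 4" using x' by (auto simp: s_def)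
      then have "dist x0 w < \<rho>" using rr(1) r \<rho> by linarith
      then show "w \<in> ball x0 \<rho>" by simp
    qed
    obtain y g where y: "y \<in> ball x' s" "GDERIV F y :> g"
      using semiconcave_differentiable_dense[OF sc sub s cont R] by blast
    have "dist y x < r"
      using y x' dist_triangle[of y x x'] r by (auto simp: s_def dist_commute)
    moreover have "y \<in> ball x0 (\<rho> / 2)"
      using \<open>dist y x < r\<close> rr dist_triangle[of x0 y x] by (auto simp: dist_commute)
    moreover have "y \<noteq> x0" using y x' s by (auto simp: s_def)
    ultimately show ?thesis using y rr by (meson less_le_trans)
  qed
  then obtain Y G where Y: "\<And>k. dist (Y k) x < 1 / Suc k" "\<And>k. Y k \<in> ball x0 (\<rho> / 2)"
      "\<And>k. Y k \<noteq> x0" "\<And>k. GDERIV F (Y k) :> G k"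
    by metis
  have Gb: "norm (G k) \<le> 8 * B / \<rho> + R * \<rho>" for k
    using semiconcave_gradient_norm_le[OF sc R \<rho> bdd Y(4) Y(2)] by blast
  have Ylim: "Y \<longlonglongrightarrow> x"
  proof (rule metric_tendsto_imp_tendsto[where a="0::real" and f="\<lambda>k. 1 / real (Suc k)"])
    show "(\<lambda>k. 1 / real (Suc k)) \<longlonglongrightarrow> 0" by (rule LIMSEQ_Suc[OF lim_1_over_n])
    show "\<forall>\<^sub>F k in sequentially. dist (Y k) x \<le> dist (1 / real (Suc k)) 0"
      using Y(1) by (intro always_eventually allI) (simp add: less_imp_le)
  qed
  have "bounded (range G)" using Gb by (auto simp: bounded_iff)
  then obtain p \<sigma> where \<sigma>: "strict_mono (\<sigma> :: nat \<Rightarrow> nat)" and Gp: "(G \<circ> \<sigma>) \<longlonglongrightarrow> p"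
    using bounded_imp_convergent_subsequence by blast
  have Yp: "(Y \<circ> \<sigma>) \<longlonglongrightarrow> x" using LIMSEQ_subseq_LIMSEQ[OF Ylim \<sigma>] .
  have xb: "x \<in> ball x0 \<rho>" using x \<rho> by auto
  have Fp: "(\<lambda>k. F ((Y \<circ> \<sigma>) k)) \<longlonglongrightarrow> F x"
    using continuous_on_eq_continuous_at[OF open_ball] cont xb Yp
    by (metis isCont_tendsto_compose)
  have Yb: "Y k \<in> ball x0 \<rho>" for k using Y(2)[of k] \<rho> by auto
  have sup: "F w \<le> F x + p \<bullet> (w - x) + 2 * R * (norm (w - x))\<^sup>2" if "w \<in> ball x0 \<rho>" for w
  proof (rule LIMSEQ_le_const)
    show "(\<lambda>k. F ((Y \<circ> \<sigma>) k) + (G \<circ> \<sigma>) k \<bullet> (w - (Y \<circ> \<sigma>) k) + 2 * R * (norm (w - (Y \<circ> \<sigma>) k))\<^sup>2)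
        \<longlonglongrightarrow> F x + p \<bullet> (w - x) + 2 * R * (norm (w - x))\<^sup>2"
      by (intro tendsto_intros Fp Gp Yp)
    show "\<exists>N. \<forall>k\<ge>N. F w \<le> F ((Y \<circ> \<sigma>) k) + (G \<circ> \<sigma>) k \<bullet> (w - (Y \<circ> \<sigma>) k) + 2 * R * (norm (w - (Y \<circ> \<sigma>) k))\<^sup>2"
      using semiconcave_gradient_bound_above[OF sc convex_ball R Y(4) Yb that] by auto
  qed
  have "\<forall>\<^sub>F k in sequentially. dist ((Y \<circ> \<sigma>) k) x < e \<and> dist ((G \<circ> \<sigma>) k) p < e"
    using tendstoD[OF Yp e] tendstoD[OF Gp e] by (rule eventually_conj)
  then obtain k where "dist ((Y \<circ> \<sigma>) k) x < e" "dist ((G \<circ> \<sigma>) k) p < e"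
    using eventually_happens'[OF sequentially_bot] by blast
  then show ?thesis
    using that[OF sup, of "Y (\<sigma> k)" "G (\<sigma> k)"] Yb Y Gb by (simp add: dist_norm)
qed

section \<open>Existence of solutions for continuous vector fields\<close>

context
  fixes \<phi> :: "'a::euclidean_space \<Rightarrow> 'a" and M s :: real and x :: 'a
  assumes cont: "continuous_on UNIV \<phi>" and bound: "\<And>y. norm (\<phi> y) \<le> M"
begin

text \<open>
  Tonelli's scheme: with the delay \<open>h\<close> the integral up to time \<open>t\<close> only involves \<open>y\<close> up to time
  \<open>t - h\<close>. For \<open>t \<le> s\<close> the integral vanishes, so the value is \<open>x\<close>.
\<close>

definition delay_map :: "real \<Rightarrow> (real \<Rightarrow> 'a) \<Rightarrow> real \<Rightarrow> 'a" where
  "delay_map h y t = x + integral {s..t} (\<lambda>r. \<phi> (y (r - h)))"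

lemma M_nonneg: "0 \<le> M" using bound norm_ge_zero order_trans by blast

lemma delay_continuous:
  assumes "continuous_on UNIV y"
  shows "continuous_on S (\<lambda>r::real. \<phi> (y (r - h)))"
  by (intro continuous_on_compose2[OF cont] continuous_on_compose2[OF assms])
     (auto intro!: continuous_intros)

lemma delay_integrable:
  assumes "continuous_on UNIV y"
  shows "(\<lambda>r. \<phi> (y (r - h))) integrable_on {u..v::real}"
  by (intro integrable_continuous_real delay_continuous assms)

lemma delay_map_lipschitz:
  assumes y: "continuous_on UNIV y"
  shows "M-lipschitz_on UNIV (delay_map h y)"
proof (rule lipschitz_on_leI)
  fix t t' :: real assume "t \<le> t'"
  have "norm (delay_map h y t' - delay_map h y t) \<le> M * (t' - t)"
  proof (cases "s \<le> t")
    case True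
    have "integral {s..t} (\<lambda>r. \<phi> (y (r - h))) + integral {t..t'} (\<lambda>r. \<phi> (y (r - h)))
        = integral {s..t'} (\<lambda>r. \<phi> (y (r - h)))"
      using True \<open>t \<le> t'\<close> delay_integrable[OF y] by (intro Henstock_Kurzweil_Integration.integral_combine) auto
    then have "delay_map h y t' - delay_map h y t = integral {t..t'} (\<lambda>r. \<phi> (y (r - h)))"
      by (simp add: delay_map_def algebra_simps)
    then show ?thesis
      using integral_bound[of t t' "\<lambda>r. \<phi> (y (r - h))" M] \<open>t \<le> t'\<close> bound delay_continuous[OF y]
      by auto
  next
    case False
    show ?thesis
    proof (cases "s \<le> t'")
      case True
      have "norm (integral {s..t'} (\<lambda>r. \<phi> (y (r - h)))) \<le> M * (t' - s)"
        using integral_bound[of s t' "\<lambda>r. \<phi> (y (r - h))" M] True bound delay_continuous[OF y]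
        by auto
      also have "\<dots> \<le> M * (t' - t)" using False M_nonneg by (intro mult_left_mono) auto
      finally show ?thesis using False by (simp add: delay_map_def)
    next
      case False
      then show ?thesis using \<open>\<not> s \<le> t\<close> M_nonneg \<open>t \<le> t'\<close> by (simp add: delay_map_def)
    qed
  qed
  then show "dist (delay_map h y t) (delay_map h y t') \<le> M * dist t t'"
    using \<open>t \<le> t'\<close> by (simp add: dist_norm norm_minus_commute)
qed (rule M_nonneg)

text \<open>
  Each application of the delay map makes the iterates stationary on a further interval of length
  \<open>h\<close>, so finitely many of them reach the time \<open>s + \<tau>\<close>.
\<close>

lemma delayed_solution_exists:
  assumes h: "0 < h"
  obtains y where "M-lipschitz_on UNIV y" "\<And>t. t \<le> s + \<tau> \<Longrightarrow> y t = delay_map h y t"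
proof -
  define Y where "Y k = (delay_map h ^^ k) (\<lambda>_. x)" for k :: nat
  have YS: "Y (Suc k) = delay_map h (Y k)" for k by (simp add: Y_def)
  have lip: "M-lipschitz_on UNIV (Y k)" for k
  proof (induction k)
    case 0 show ?case unfolding Y_def using M_nonneg by (auto intro!: lipschitz_onI)
  next
    case (Suc k)
    show ?case unfolding YS by (intro delay_map_lipschitz lipschitz_on_continuous_on[OF Suc])
  qed
  have stable: "Y (Suc k) t = Y k t" if "t \<le> s + k * h" for k t
    using that
  proof (induction k arbitrary: t)
    case 0 then show ?case unfolding YS
      by (cases "t = s") (auto simp: delay_map_def Y_def)
  next
    case (Suc k)
    have "integral {s..t} (\<lambda>r. \<phi> (Y (Suc k) (r - h))) = integral {s..t} (\<lambda>r. \<phi> (Y k (r - h)))"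
      by (intro integral_cong arg_cong[of _ _ \<phi>] Suc.IH) (use Suc.prems in \<open>auto simp: algebra_simps\<close>)
    moreover have "Y (Suc (Suc k)) t = x + integral {s..t} (\<lambda>r. \<phi> (Y (Suc k) (r - h)))"
      by (simp only: YS[of "Suc k"] delay_map_def)
    moreover have "Y (Suc k) t = x + integral {s..t} (\<lambda>r. \<phi> (Y k (r - h)))"
      by (simp only: YS[of k] delay_map_def)
    ultimately show ?case by simp
  qed
  obtain N :: nat where N: "\<tau> / h \<le> N" using real_arch_simple by blast
  have "Y N t = delay_map h (Y N) t" if "t \<le> s + \<tau>" for t
    using stable[of t N] that N h by (auto simp: YS field_simps)
  with lip that show ?thesis by blast
qed

text \<open>
  Peano's theorem for a bounded continuous vector field. The solutions with delay \<open>1 / (k + 1)\<close> share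
  the Lipschitz constant \<open>M\<close>, so by Arzela and Ascoli a subsequence converges uniformly, and
  dominated convergence passes to the limit in the integral equation.
\<close>

lemma peano:
  obtains z where "z s = x"
    "\<And>t. t \<in> {s..s + \<tau>} \<Longrightarrow> (z has_vector_derivative \<phi> (z t)) (at t within {s..s + \<tau>})"
proof -
  define h where "h k = 1 / real (Suc k)" for k
  have h: "0 < h k" for k by (simp add: h_def)
  have hlim: "h \<longlonglongrightarrow> 0" unfolding h_def by (rule LIMSEQ_Suc[OF lim_1_over_n])
  have "\<forall>k. \<exists>y. M-lipschitz_on UNIV y \<and> (\<forall>t\<le>s + \<tau>. y t = delay_map (h k) y t)"
    using delayed_solution_exists[OF h] by metis
  then obtain Y where lip: "\<And>k. M-lipschitz_on UNIV (Y k)"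
    and Y: "\<And>k t. t \<le> s + \<tau> \<Longrightarrow> Y k t = delay_map (h k) (Y k) t" by metis
  have Ylip: "norm (Y k t - Y k t') \<le> M * \<bar>t - t'\<bar>" for k t t'
    using lipschitz_onD[OF lip, of t t'] by (simp add: dist_norm)
  have bdd: "norm (Y k t) \<le> norm x + M * \<tau>" if "t \<in> {s..s + \<tau>}" for k t
  proof -
    have "Y k s = x" using Y[of s k] that by (simp add: delay_map_def)
    then have "norm (Y k t) \<le> norm x + M * \<bar>t - s\<bar>"
      using Ylip[of k t s] norm_triangle_sub[of "Y k t" x] by simp
    also have "\<dots> \<le> norm x + M * \<tau>" using that M_nonneg by (auto intro!: mult_left_mono)
    finally show ?thesis .
  qed
  have equi: "\<exists>d>0. \<forall>k t'. t' \<in> {s..s + \<tau>} \<and> norm (t - t') < d \<longrightarrow> norm (Y k t - Y k t') < e"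
    if e: "0 < e" for t e
  proof (intro exI[of _ "e / (M + 1)"] conjI allI impI)
    show "0 < e / (M + 1)" using e M_nonneg by simp
    fix k t' assume "t' \<in> {s..s + \<tau>} \<and> norm (t - t') < e / (M + 1)"
    then have "(M + 1) * \<bar>t - t'\<bar> < e" using M_nonneg by (simp add: field_simps)
    moreover have "M * \<bar>t - t'\<bar> \<le> (M + 1) * \<bar>t - t'\<bar>" by (intro mult_right_mono) auto
    ultimately show "norm (Y k t - Y k t') < e" using Ylip[of k t t'] by linarith
  qed
  obtain z \<sigma> where zc: "continuous_on {s..s + \<tau>} z" and \<sigma>: "strict_mono (\<sigma> :: nat \<Rightarrow> nat)"
    and unif: "\<And>e. 0 < e \<Longrightarrow> \<exists>N. \<forall>k t. k \<ge> N \<and> t \<in> {s..s + \<tau>} \<longrightarrow> norm (Y (\<sigma> k) t - z t) < e"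
    using Arzela_Ascoli[OF compact_Icc, of s "s + \<tau>" Y "norm x + M * \<tau>"] bdd equi by blast
  have ptw: "(\<lambda>k. Y (\<sigma> k) t) \<longlonglongrightarrow> z t" if "t \<in> {s..s + \<tau>}" for t
    unfolding lim_sequentially dist_norm using unif that by blast
  have h\<sigma>: "(\<lambda>k. h (\<sigma> k)) \<longlonglongrightarrow> 0" using LIMSEQ_subseq_LIMSEQ[OF hlim \<sigma>] by (simp add: o_def)
  have delayed: "(\<lambda>k. Y (\<sigma> k) (t - h (\<sigma> k))) \<longlonglongrightarrow> z t" if "t \<in> {s..s + \<tau>}" for t
  proof -
    have "(\<lambda>k. Y (\<sigma> k) (t - h (\<sigma> k)) - Y (\<sigma> k) t) \<longlonglongrightarrow> 0"
    proof (rule tendsto_0_le[where K=1])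
      show "(\<lambda>k. M * h (\<sigma> k)) \<longlonglongrightarrow> 0" using tendsto_mult_left[OF h\<sigma>, of M] by simp
      show "\<forall>\<^sub>F k in sequentially. norm (Y (\<sigma> k) (t - h (\<sigma> k)) - Y (\<sigma> k) t) \<le> norm (M * h (\<sigma> k)) * 1"
      proof (intro always_eventually allI)
        fix k
        show "norm (Y (\<sigma> k) (t - h (\<sigma> k)) - Y (\<sigma> k) t) \<le> norm (M * h (\<sigma> k)) * 1"
          using Ylip[of "\<sigma> k" "t - h (\<sigma> k)" t] M_nonneg h[of "\<sigma> k"] by (simp add: abs_mult)
      qed
    qed
    from tendsto_add[OF this ptw[OF that]] show ?thesis by simp
  qed
  have z_eq: "z t = x + integral {s..t} (\<lambda>r. \<phi> (z r))" if t: "t \<in> {s..s + \<tau>}" for t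
  proof -
    have "(\<lambda>k. integral {s..t} (\<lambda>r. \<phi> (Y (\<sigma> k) (r - h (\<sigma> k))))) \<longlonglongrightarrow> integral {s..t} (\<lambda>r. \<phi> (z r))"
    proof (rule dominated_convergence(2)[where h="\<lambda>_. M"])
      show "(\<lambda>r. \<phi> (Y (\<sigma> k) (r - h (\<sigma> k)))) integrable_on {s..t}" for k
        by (intro delay_integrable lipschitz_on_continuous_on[OF lip])
      show "(\<lambda>k. \<phi> (Y (\<sigma> k) (r - h (\<sigma> k)))) \<longlonglongrightarrow> \<phi> (z r)" if "r \<in> {s..t}" for r
      proof (rule isCont_tendsto_compose[OF _ delayed])
        show "isCont \<phi> (z r)" using cont by (simp add: continuous_on_eq_continuous_at)
      qed (use that t in auto)
    qed (auto intro: bound integrable_const_ivl)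
    then have "(\<lambda>k. Y (\<sigma> k) t) \<longlonglongrightarrow> x + integral {s..t} (\<lambda>r. \<phi> (z r))"
      using Y t by (simp add: delay_map_def tendsto_add)
    with ptw[OF t] show ?thesis by (rule LIMSEQ_unique)
  qed
  \<comment> \<open>On the interval \<open>z'\<close> agrees with \<open>z\<close>, and the fundamental theorem applies to it literally.\<close>
  define z' where "z' t = x + integral {s..t} (\<lambda>r. \<phi> (z r))" for t
  show ?thesis
  proof (rule that[of z'])
    show "z' s = x" by (simp add: z'_def)
    fix t assume t: "t \<in> {s..s + \<tau>}"
    have "continuous_on {s..s + \<tau>} (\<lambda>r. \<phi> (z r))" using cont zc by (rule continuous_on_compose2) auto
    from integral_has_vector_derivative[OF this t]
    have "(z' has_vector_derivative \<phi> (z t)) (at t within {s..s + \<tau>})"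
      unfolding z'_def by (auto intro!: derivative_eq_intros)
    then show "(z' has_vector_derivative \<phi> (z' t)) (at t within {s..s + \<tau>})"
      using z_eq[OF t] by (simp add: z'_def)
  qed
qed

end

section \<open>Majorants of class KL\<close>

definition cutoff :: "real \<Rightarrow> real" where
  "cutoff u = max 0 (min 1 (1 - u))"

lemma cutoff_bounds: "0 \<le> cutoff u" "cutoff u \<le> 1"
  and cutoff_eq_1: "u \<le> 0 \<Longrightarrow> cutoff u = 1"
  and cutoff_eq_0: "1 \<le> u \<Longrightarrow> cutoff u = 0"
  and cutoff_antimono: "u \<le> v \<Longrightarrow> cutoff v \<le> cutoff u"
  and cutoff_lipschitz: "\<bar>cutoff u - cutoff v\<bar> \<le> \<bar>u - v\<bar>"
  by (auto simp: cutoff_def)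

text \<open>
  A family of nonnegative functions \<open>g i\<close> of time with initial sizes \<open>\<rho> i\<close> that is uniformly stable
  (\<open>small\<close>), uniformly bounded (\<open>bounded\<close>) and uniformly attractive (\<open>attract\<close>) has a common majorant of
  class \<open>KL\<close>. The least candidate, the supremum of \<open>g i s\<close> over \<open>\<rho> i \<le> r\<close> and \<open>s \<ge> t\<close>, is monotone
  but in general discontinuous. Replacing the sharp constraints by Lipschitz cutoffs, which equal
  \<open>1\<close> there and vanish for \<open>\<rho> i \<ge> 2 r\<close> or \<open>s \<le> t - 1\<close>, makes the supremum \<open>W\<close> locally Lipschitz for
  \<open>r > 0\<close>, as a supremum of uniformly Lipschitz functions. The summand \<open>r * exp (- t)\<close> makes the
  majorant strictly increasing and unbounded in \<open>r\<close>.
\<close>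

lemma KL_majorant:
  fixes \<rho> :: "'i \<Rightarrow> real" and g :: "'i \<Rightarrow> real \<Rightarrow> real"
  assumes nonneg: "\<And>i. i \<in> I \<Longrightarrow> 0 \<le> \<rho> i" "\<And>i t. i \<in> I \<Longrightarrow> 0 \<le> t \<Longrightarrow> 0 \<le> g i t"
    and small: "\<And>e. 0 < e \<Longrightarrow> \<exists>d>0. \<forall>i\<in>I. \<rho> i \<le> d \<longrightarrow> (\<forall>t\<ge>0. g i t \<le> e)"
    and bounded: "\<And>r. \<exists>M. \<forall>i\<in>I. \<rho> i \<le> r \<longrightarrow> (\<forall>t\<ge>0. g i t \<le> M)"
    and attract: "\<And>r e. 0 < e \<Longrightarrow> \<exists>T. \<forall>i\<in>I. \<rho> i \<le> r \<longrightarrow> (\<forall>t\<ge>0. T \<le> t \<longrightarrow> g i t \<le> e)"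
  shows "\<exists>\<beta>. class_KL \<beta> \<and> (\<forall>i\<in>I. \<forall>t\<ge>0. g i t \<le> \<beta> (\<rho> i) t)"
proof -
  define c where "c r t = (\<lambda>(i, s). g i s * (cutoff (\<rho> i / r - 1) * cutoff (t - s)))" for r t
  define P where "P = I \<times> {0::real..}"
  \<comment> \<open>At \<open>r = 0\<close> the quotient \<open>\<rho> i / r\<close> is \<open>0\<close> and the cutoff would not act, so the value is prescribed.\<close>
  define W where "W r t = (if r = 0 then 0 else Sup (insert 0 (c r t ` P)))" for r t
  define \<beta> where "\<beta> r t = W r t + r * exp (- t)" for r t
  have c0: "0 \<le> c r t p" if "p \<in> P" for r t p
    using that nonneg by (auto simp: c_def P_def cutoff_bounds)
  have c_le: "c r t p \<le> g (fst p) (snd p)" if "p \<in> P" for r t p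
  proof -
    have "g (fst p) (snd p) * (cutoff (\<rho> (fst p) / r - 1) * cutoff (t - snd p)) \<le> g (fst p) (snd p) * (1 * 1)"
      using that nonneg by (intro mult_left_mono mult_mono) (auto simp: P_def cutoff_bounds)
    then show ?thesis by (simp add: c_def case_prod_beta)
  qed
  have c_far: "c r t p = 0" if "0 < r" "2 * r \<le> \<rho> (fst p)" for r t p
    using that by (simp add: c_def case_prod_beta cutoff_eq_0 field_simps)
  have c_late: "c r t p = 0" if "snd p + 1 \<le> t" for r t p
    using that by (simp add: c_def case_prod_beta cutoff_eq_0)
  have W_least: "W r t \<le> b" if "0 \<le> b" "\<And>p. r \<noteq> 0 \<Longrightarrow> p \<in> P \<Longrightarrow> c r t p \<le> b" for r t b
    using that by (auto simp: W_def intro!: cSup_least)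
  have bdd: "bdd_above (insert 0 (c r t ` P))" if r: "0 < r" for r t
  proof -
    obtain M where M: "\<forall>i\<in>I. \<rho> i \<le> 2 * r \<longrightarrow> (\<forall>t\<ge>0. g i t \<le> M)" using bounded by blast
    have "c r t p \<le> max 0 M" if "p \<in> P" for p
    proof (cases "\<rho> (fst p) \<le> 2 * r")
      case True
      then have "g (fst p) (snd p) \<le> M" using M that by (auto simp: P_def)
      with c_le[OF that, of r t] show ?thesis by linarith
    next
      case False then show ?thesis using c_far[OF r] by simp
    qed
    then show ?thesis by (intro bdd_aboveI[of _ "max 0 M"]) auto
  qed
  have W_upper: "c r t p \<le> W r t" if "0 < r" "p \<in> P" for r t p
    using cSup_upper[OF _ bdd[OF that(1)]] that by (auto simp: W_def)
  have W0: "0 \<le> W r t" if "0 \<le> r" for r t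
    using cSup_upper[OF _ bdd, of 0 r t] that by (auto simp: W_def)
  have W_mono: "W r t \<le> W r' t" if "0 \<le> r" "r \<le> r'" for r r' t
  proof (rule W_least)
    show "0 \<le> W r' t" using W0 that by auto
    fix p assume "r \<noteq> 0" and p: "p \<in> P"
    with that have r: "0 < r" "0 < r'" by auto
    have "\<rho> (fst p) / r' \<le> \<rho> (fst p) / r"
      using that r p nonneg by (intro divide_left_mono) (auto simp: P_def)
    then have "c r t p \<le> c r' t p"
      using p nonneg unfolding c_def case_prod_beta
      by (intro mult_left_mono mult_right_mono cutoff_antimono) (auto simp: P_def cutoff_bounds)
    also have "\<dots> \<le> W r' t" using W_upper r p by blast
    finally show "c r t p \<le> W r' t" .
  qed
  have W_anti: "W r t' \<le> W r t" if "0 \<le> r" "t \<le> t'" for r t t'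
  proof (rule W_least)
    show "0 \<le> W r t" using W0 that by auto
    fix p assume "r \<noteq> 0" and p: "p \<in> P"
    with that have r: "0 < r" by auto
    have "c r t' p \<le> c r t p"
      using p nonneg that unfolding c_def case_prod_beta
      by (intro mult_left_mono cutoff_antimono) (auto simp: P_def cutoff_bounds)
    also have "\<dots> \<le> W r t" using W_upper r p by blast
    finally show "c r t' p \<le> W r t" .
  qed
  have W_lim: "(W r \<longlongrightarrow> 0) at_top" if r: "0 \<le> r" for r
  proof (rule order_tendstoI)
    fix a :: real assume "a < 0"
    then show "\<forall>\<^sub>F t in at_top. a < W r t" using W0[OF r] by (intro always_eventually allI) (rule less_le_trans)
  next
    fix e :: real assume e: "0 < e"
    then obtain T where T: "\<forall>i\<in>I. \<rho> i \<le> 2 * r \<longrightarrow> (\<forall>t\<ge>0. T \<le> t \<longrightarrow> g i t \<le> e / 2)"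
      using attract[of "e / 2" "2 * r"] by (meson half_gt_zero)
    have "W r t \<le> e / 2" if t: "T + 1 \<le> t" for t
    proof (rule W_least)
      fix p assume "r \<noteq> 0" and p: "p \<in> P"
      with r have r: "0 < r" by auto
      show "c r t p \<le> e / 2"
      proof (cases "\<rho> (fst p) \<le> 2 * r \<and> T \<le> snd p")
        case True
        then have "g (fst p) (snd p) \<le> e / 2" using T p by (auto simp: P_def)
        with c_le[OF p, of r t] show ?thesis by linarith
      next
        case False
        then have "2 * r \<le> \<rho> (fst p) \<or> snd p + 1 \<le> t" using t by linarith
        then have "c r t p = 0" using c_far[OF r, of p t] c_late[of p t r] by blast
        then show ?thesis using e by simp
      qed
    qed (use e in auto)
    moreover have "e / 2 < e" using e by simp
    ultimately have "\<forall>t\<ge>T + 1. W r t < e" by (blast intro: le_less_trans)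
    then show "\<forall>\<^sub>F t in at_top. W r t < e" using eventually_at_top_linorder by blast
  qed
  \<comment> \<open>Local Lipschitz continuity at \<open>(r0, t0)\<close>. Only indices with \<open>\<rho> i \<le> 4 * r0\<close> matter for \<open>r < 2 * r0\<close>,
    and on these \<open>r \<mapsto> \<rho> i / r\<close> has the Lipschitz constant \<open>8 / r0\<close> on \<open>r \<ge> r0 / 2\<close>.\<close>
  have W_close: "\<exists>M\<ge>0. \<forall>r t. \<bar>r - r0\<bar> < r0 / 2 \<longrightarrow> \<bar>W r t - W r0 t0\<bar> \<le> M * (8 * \<bar>r - r0\<bar> / r0 + \<bar>t - t0\<bar>)"
    if r0: "0 < r0" for r0 t0
  proof -
    obtain M' where M': "\<forall>i\<in>I. \<rho> i \<le> 4 * r0 \<longrightarrow> (\<forall>t\<ge>0. g i t \<le> M')" using bounded by blast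
    define M where "M = max 0 M'"
    have "\<bar>W r t - W r0 t0\<bar> \<le> M * (8 * \<bar>r - r0\<bar> / r0 + \<bar>t - t0\<bar>)" if near: "\<bar>r - r0\<bar> < r0 / 2" for r t
    proof -
      define E where "E = M * (8 * \<bar>r - r0\<bar> / r0 + \<bar>t - t0\<bar>)"
      have E: "0 \<le> E" using r0 by (simp add: E_def M_def)
      have r: "0 < r" "r0 / 2 \<le> r" "r < 2 * r0" using near r0 by linarith+
      have cc: "\<bar>c r t p - c r0 t0 p\<bar> \<le> E" if p: "p \<in> P" for p
      proof (cases "\<rho> (fst p) \<le> 4 * r0")
        case True
        let ?i = "fst p" and ?s = "snd p"
        have "g ?i ?s \<le> M'" using M' True p by (auto simp: P_def)
        then have g: "0 \<le> g ?i ?s" "g ?i ?s \<le> M" using p nonneg by (auto simp: P_def M_def)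
        have "\<bar>\<rho> ?i / r - \<rho> ?i / r0\<bar> = \<rho> ?i * \<bar>r - r0\<bar> / (r * r0)"
        proof -
          have "\<rho> ?i / r - \<rho> ?i / r0 = \<rho> ?i * (r0 - r) / (r * r0)" using r r0 by (simp add: field_simps)
          moreover have "0 \<le> \<rho> ?i" using nonneg p by (auto simp: P_def)
          ultimately show ?thesis using r r0 by (simp add: abs_mult abs_minus_commute)
        qed
        also have "\<dots> \<le> 4 * r0 * \<bar>r - r0\<bar> / (r0 / 2 * r0)"
          using True r r0 nonneg p by (intro frac_le mult_right_mono mult_pos_pos mult_nonneg_nonneg) (auto simp: P_def)
        also have "\<dots> = 8 * \<bar>r - r0\<bar> / r0" using r0 by (simp add: field_simps)
        finally have A: "\<bar>cutoff (\<rho> ?i / r - 1) - cutoff (\<rho> ?i / r0 - 1)\<bar> \<le> 8 * \<bar>r - r0\<bar> / r0"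
          using cutoff_lipschitz[of "\<rho> ?i / r - 1" "\<rho> ?i / r0 - 1"] by simp
        have B: "\<bar>cutoff (t - ?s) - cutoff (t0 - ?s)\<bar> \<le> \<bar>t - t0\<bar>"
          using cutoff_lipschitz[of "t - ?s" "t0 - ?s"] by simp
        have "\<bar>cutoff (\<rho> ?i / r - 1) * cutoff (t - ?s) - cutoff (\<rho> ?i / r0 - 1) * cutoff (t0 - ?s)\<bar>
            = \<bar>(cutoff (\<rho> ?i / r - 1) - cutoff (\<rho> ?i / r0 - 1)) * cutoff (t - ?s)
              + cutoff (\<rho> ?i / r0 - 1) * (cutoff (t - ?s) - cutoff (t0 - ?s))\<bar>" by (simp add: algebra_simps)
        also have "\<dots> \<le> \<bar>cutoff (\<rho> ?i / r - 1) - cutoff (\<rho> ?i / r0 - 1)\<bar> * cutoff (t - ?s)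
              + cutoff (\<rho> ?i / r0 - 1) * \<bar>cutoff (t - ?s) - cutoff (t0 - ?s)\<bar>"
          by (rule order_trans[OF abs_triangle_ineq]) (simp add: abs_mult cutoff_bounds)
        also have "\<dots> \<le> 8 * \<bar>r - r0\<bar> / r0 * 1 + 1 * \<bar>t - t0\<bar>"
          using A B r0 by (intro add_mono mult_mono) (auto simp: cutoff_bounds)
        finally have D: "\<bar>cutoff (\<rho> ?i / r - 1) * cutoff (t - ?s) - cutoff (\<rho> ?i / r0 - 1) * cutoff (t0 - ?s)\<bar>
          \<le> 8 * \<bar>r - r0\<bar> / r0 + \<bar>t - t0\<bar>" by simp
        have "\<bar>c r t p - c r0 t0 p\<bar> = g ?i ?s * \<bar>cutoff (\<rho> ?i / r - 1) * cutoff (t - ?s) - cutoff (\<rho> ?i / r0 - 1) * cutoff (t0 - ?s)\<bar>"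
          using g by (simp add: c_def case_prod_beta right_diff_distrib[symmetric] abs_mult)
        also have "\<dots> \<le> E" unfolding E_def using g D by (intro mult_mono) auto
        finally show ?thesis .
      next
        case False
        then show ?thesis using c_far[of r p t] c_far[of r0 p t0] r r0 E by auto
      qed
      have "W r t \<le> W r0 t0 + E"
      proof (rule W_least)
        show "0 \<le> W r0 t0 + E" using W0 r0 E by (simp add: add_nonneg_nonneg less_imp_le)
        show "c r t p \<le> W r0 t0 + E" if "p \<in> P" for p
          using cc[OF that] W_upper[OF r0 that, of t0] by linarith
      qed
      moreover have "W r0 t0 \<le> W r t + E"
      proof (rule W_least)
        show "0 \<le> W r t + E" using W0 r E by (simp add: add_nonneg_nonneg less_imp_le)
        show "c r0 t0 p \<le> W r t + E" if "p \<in> P" for p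
          using cc[OF that] W_upper[OF r(1) that, of t] by linarith
      qed
      ultimately show ?thesis unfolding E_def by linarith
    qed
    then show ?thesis by (intro exI[of _ M]) (auto simp: M_def)
  qed
  have cont: "continuous_on ({0..} \<times> {0..}) (\<lambda>(r, t). W r t)"
    unfolding continuous_on_eq_continuous_within
  proof (intro ballI)
    fix q :: "real \<times> real" assume q: "q \<in> {0..} \<times> {0..}"
    obtain r0 t0 where q_eq: "q = (r0, t0)" by force
    have "((\<lambda>p. W (fst p) (snd p) - W r0 t0) \<longlongrightarrow> 0) (at q within {0..} \<times> {0..})"
    proof (cases "r0 = 0")
      case True
      show ?thesis
      proof (rule tendstoI)
        fix e :: real assume "0 < e"
        then obtain d where d: "0 < d" "\<forall>i\<in>I. \<rho> i \<le> d \<longrightarrow> (\<forall>t\<ge>0. g i t \<le> e / 2)"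
          using small[of "e / 2"] by (meson half_gt_zero)
        have W_small: "W r t \<le> e / 2" if "0 \<le> r" "r < d / 2" for r t
        proof (rule W_least)
          fix p assume "r \<noteq> 0" and p: "p \<in> P"
          with that have r: "0 < r" by auto
          show "c r t p \<le> e / 2"
          proof (cases "\<rho> (fst p) \<le> d")
            case True
            then have "g (fst p) (snd p) \<le> e / 2" using d p by (auto simp: P_def)
            with c_le[OF p, of r t] show ?thesis by linarith
          next
            case False then show ?thesis using c_far[OF r, of p t] that \<open>0 < e\<close> by simp
          qed
        qed (use \<open>0 < e\<close> in auto)
        have "dist (W (fst p) (snd p) - W r0 t0) 0 < e" if "p \<in> {0..} \<times> {0..}" "dist p q < d / 2" for p
        proof -
          have "fst p < d / 2" using that(2) dist_fst_le[of p q] True by (simp add: q_eq dist_real_def)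
          moreover have "0 \<le> fst p" using that by auto
          moreover have "W r0 t0 = 0" using True by (simp add: W_def)
          ultimately show ?thesis using W_small[of "fst p" "snd p"] W0[of "fst p" "snd p"] \<open>0 < e\<close> by simp
        qed
        then show "\<forall>\<^sub>F p in at q within {0..} \<times> {0..}. dist (W (fst p) (snd p) - W r0 t0) 0 < e"
          unfolding eventually_at using d(1) by (intro exI[of _ "d / 2"]) auto
      qed
    next
      case False
      then have r0: "0 < r0" using q q_eq by auto
      then obtain M where M: "0 \<le> M" "\<And>r t. \<bar>r - r0\<bar> < r0 / 2 \<Longrightarrow>
          \<bar>W r t - W r0 t0\<bar> \<le> M * (8 * \<bar>r - r0\<bar> / r0 + \<bar>t - t0\<bar>)"
        using W_close by blast
      show ?thesis
      proof (rule tendsto_0_le[where K=1])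
        have "((\<lambda>p. M * (8 * \<bar>fst p - r0\<bar> / r0 + \<bar>snd p - t0\<bar>)) \<longlongrightarrow> M * (8 * \<bar>fst q - r0\<bar> / r0 + \<bar>snd q - t0\<bar>))
            (at q within {0..} \<times> {0..})"
          using r0 by (intro tendsto_intros) auto
        then show "((\<lambda>p. M * (8 * \<bar>fst p - r0\<bar> / r0 + \<bar>snd p - t0\<bar>)) \<longlongrightarrow> 0) (at q within {0..} \<times> {0..})"
          by (simp add: q_eq)
        have "norm (W (fst p) (snd p) - W r0 t0) \<le> norm (M * (8 * \<bar>fst p - r0\<bar> / r0 + \<bar>snd p - t0\<bar>)) * 1"
          if "dist p q < r0 / 2" for p
        proof -
          have "\<bar>fst p - r0\<bar> < r0 / 2" using that dist_fst_le[of p q] by (simp add: q_eq dist_real_def)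
          from M(2)[OF this, of "snd p"] show ?thesis using M(1) r0 by simp
        qed
        then show "\<forall>\<^sub>F p in at q within {0..} \<times> {0..}. norm (W (fst p) (snd p) - W r0 t0)
            \<le> norm (M * (8 * \<bar>fst p - r0\<bar> / r0 + \<bar>snd p - t0\<bar>)) * 1"
          unfolding eventually_at using r0 by (intro exI[of _ "r0 / 2"]) auto
      qed
    qed
    then show "continuous (at q within {0..} \<times> {0..}) (\<lambda>(r, t). W r t)"
      unfolding continuous_within by (subst (asm) LIM_zero_iff) (simp add: q_eq case_prod_beta')
  qed
  have "class_KL \<beta>"
    unfolding class_KL_def
  proof (intro conjI allI impI)
    show "continuous_on ({0..} \<times> {0..}) (\<lambda>(r, t). \<beta> r t)"
      using cont unfolding \<beta>_def case_prod_beta by (intro continuous_intros)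
    fix r t :: real
    { assume "0 \<le> r" "0 \<le> t" then show "0 \<le> \<beta> r t" using W0 by (simp add: \<beta>_def) }
    { assume "0 \<le> r" show "antimono_on {0..} (\<beta> r)"
      proof (rule monotone_onI)
        fix t t' :: real assume "t \<le> t'"
        then show "\<beta> r t' \<le> \<beta> r t" unfolding \<beta>_def using \<open>0 \<le> r\<close>
          by (intro add_mono W_anti mult_left_mono) auto
      qed }
    { assume "0 \<le> r"
      have "((\<lambda>t. r * exp (- t)) \<longlongrightarrow> r * 0) at_top"
        by (intro tendsto_intros filterlim_compose[OF exp_at_bot] filterlim_uminus_at_bot_at_top)
      from tendsto_add[OF W_lim[OF \<open>0 \<le> r\<close>] this] show "(\<beta> r \<longlongrightarrow> 0) at_top"
        unfolding \<beta>_def by simp }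
    { show "\<beta> 0 t = 0" by (simp add: \<beta>_def W_def) }
    { show "strict_mono_on {0..} (\<lambda>r. \<beta> r t)"
        unfolding \<beta>_def by (intro strict_mono_onI add_le_less_mono W_mono) auto }
    { fix M :: real
      show "\<exists>r\<ge>0. M < \<beta> r t"
      proof (intro exI[of _ "(\<bar>M\<bar> + 1) * exp t"] conjI)
        have "W ((\<bar>M\<bar> + 1) * exp t) t \<ge> 0" by (intro W0) auto
        then show "M < \<beta> ((\<bar>M\<bar> + 1) * exp t) t" by (simp add: \<beta>_def mult.assoc exp_minus)
      qed auto }
  qed
  moreover have "g i t \<le> \<beta> (\<rho> i) t" if i: "i \<in> I" and t: "0 \<le> t" for i t
  proof (cases "\<rho> i = 0")
    case True
    have "g i t \<le> 0 + e" if "0 < e" for e using small[OF that] True i t by auto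
    then have "g i t \<le> 0" by (rule field_le_epsilon)
    then show ?thesis using True by (simp add: \<beta>_def W_def)
  next
    case False
    then have "0 < \<rho> i" using nonneg(1)[OF i] by auto
    then have "g i t \<le> W (\<rho> i) t"
      using W_upper[of "\<rho> i" "(i, t)" t] i t by (simp add: c_def P_def cutoff_eq_1)
    then show ?thesis using \<open>0 < \<rho> i\<close> by (simp add: \<beta>_def add_increasing2)
  qed
  ultimately show ?thesis by blast
qed

section \<open>Arcs along which the restraint function decreases\<close>

lemma vector_derivative_bound_lipschitz:
  fixes z :: "real \<Rightarrow> 'a::real_normed_vector"
  assumes "\<And>t. t \<in> {a..b} \<Longrightarrow> (z has_vector_derivative z' t) (at t within {a..b})"
    and "\<And>t. t \<in> {a..b} \<Longrightarrow> norm (z' t) \<le> M" and "0 \<le> M"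
  shows "M-lipschitz_on {a..b} z"
proof (rule bounded_derivative_imp_lipschitz)
  fix t assume t: "t \<in> {a..b}"
  show "(z has_derivative (\<lambda>h. h *\<^sub>R z' t)) (at t within {a..b})"
    using assms(1)[OF t] by (simp add: has_vector_derivative_def)
  show "onorm (\<lambda>h. h *\<^sub>R z' t) \<le> M"
  proof (rule onorm_le)
    fix h :: real
    show "norm (h *\<^sub>R z' t) \<le> M * norm h"
      using mult_right_mono[OF assms(2)[OF t], of "norm h"] by (simp add: mult.commute)
  qed
qed (use assms in auto)

text \<open>
  The locale fixes one constant \<open>p0 \<ge> 0\<close> for the restraint function. Controllability uses whichever
  constant the restraint function comes with, the bound for the value function a positive one.
\<close>

locale restraint =
  fixes C :: "(real^'n) set" and A :: "(real^'m) set"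
    and f :: "(real^'n) \<times> (real^'m) \<Rightarrow> real^'n"
    and l :: "(real^'n) \<times> (real^'m) \<Rightarrow> real"
    and U :: "real^'n \<Rightarrow> real" and p0 :: real
  assumes compact_A: "compact A"
    and closed_C: "closed C" and compact_frontier: "compact (frontier C)"
    and cont_f: "continuous_on ((- C) \<times> A) f"
    and cont_l: "continuous_on ((- C) \<times> A) l"
    and l_nonneg: "\<And>x a. x \<in> - C \<Longrightarrow> a \<in> A \<Longrightarrow> 0 \<le> l (x, a)"
    and mrf: "minimum_restraint_function_with C A f l p0 U"
begin

lemma p0_nonneg: "0 \<le> p0"
  using mrf by (simp add: minimum_restraint_function_with_def)

lemma U_continuous: "continuous_on (closure (- C)) U"
  using mrf by (simp add: minimum_restraint_function_with_def)

lemma U_pos: "x \<in> - C \<Longrightarrow> 0 < U x"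
  using mrf by (simp add: minimum_restraint_function_with_def positive_definite_def)

lemma cont_f_control: "a \<in> A \<Longrightarrow> S \<subseteq> - C \<Longrightarrow> continuous_on S (\<lambda>y. f (y, a))"
  by (rule continuous_on_compose2[OF cont_f]) (auto intro!: continuous_intros)

lemma cont_l_control: "a \<in> A \<Longrightarrow> S \<subseteq> - C \<Longrightarrow> continuous_on S (\<lambda>y. l (y, a))"
  by (rule continuous_on_compose2[OF cont_l]) (auto intro!: continuous_intros)

lemma closure_compl_cases: "x \<in> closure (- C) \<Longrightarrow> x \<in> - C \<or> x \<in> frontier C \<and> U x = 0"
  using mrf closed_C unfolding minimum_restraint_function_with_def positive_definite_def
  by (auto simp: frontier_closures)

text \<open>
  Near \<open>x0\<close> there are, for every \<open>x\<close>, a control and a proximal supergradient that satisfy the strict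
  Hamiltonian inequality with one common margin \<open>c\<close>, on one common ball. If this failed on balls
  shrinking to \<open>x0\<close>, the supergradients at the bad points would accumulate at some \<open>p\<close>, which is a
  limiting gradient at \<open>x0\<close> since each of them is approximated by gradients. A control with negative
  Hamiltonian at \<open>(x0, p)\<close> then remains good nearby, by continuity of \<open>f\<close> and \<open>l\<close>.
\<close>

lemma uniform_descent_direction:
  assumes x0: "x0 \<in> - C"
  obtains d c R where "0 < d" "0 < c" "0 \<le> R" "ball x0 d \<subseteq> - C"
    "\<And>x. x \<in> ball x0 d \<Longrightarrow> \<exists>a\<in>A. \<exists>p. \<forall>y\<in>ball x0 d.
        p0 * l (y, a) + p \<bullet> f (y, a) \<le> - c \<and> U y \<le> U x + p \<bullet> (y - x) + R * (norm (y - x))\<^sup>2"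
proof -
  obtain R \<rho>0 where R: "0 < R" and \<rho>0: "0 < \<rho>0" "ball x0 \<rho>0 \<subseteq> - C"
    and sc0: "semiconcave_on (ball x0 \<rho>0) R U"
    using mrf x0 unfolding minimum_restraint_function_with_def locally_semiconcave_def semiconcave_on_def
    by blast
  define \<rho> where "\<rho> = \<rho>0 / 2"
  have \<rho>: "0 < \<rho>" "cball x0 \<rho> \<subseteq> ball x0 \<rho>0" using \<rho>0 by (auto simp: \<rho>_def)
  have sub: "cball x0 \<rho> \<subseteq> - C" using \<rho> \<rho>0 by blast
  then have sub': "ball x0 \<rho> \<subseteq> - C" using ball_subset_cball by blast
  have sc: "semiconcave_on (ball x0 \<rho>) R U" using sc0 \<rho> unfolding semiconcave_on_def
    by (meson ball_subset_cball subsetD)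
  have contb: "continuous_on (cball x0 \<rho>) U"
    using U_continuous sub closure_subset by (metis continuous_on_subset subset_trans)
  then have cont: "continuous_on (ball x0 \<rho>) U" using ball_subset_cball continuous_on_subset by blast
  obtain B where "\<forall>v\<in>U ` cball x0 \<rho>. norm v \<le> B"
    using compact_imp_bounded[OF compact_continuous_image[OF contb compact_cball]]
    unfolding bounded_iff by blast
  then have B: "\<And>y. y \<in> ball x0 \<rho> \<Longrightarrow> \<bar>U y\<bar> \<le> B" by auto
  define e where "e k = 1 / real (Suc k)" for k
  have e: "0 < e k" for k by (simp add: e_def)
  have elim: "e \<longlonglongrightarrow> 0" unfolding e_def by (rule LIMSEQ_Suc[OF lim_1_over_n])
  \<comment> \<open>The factor \<open>2 * R\<close> is the loss in passing from the midpoint inequality to the gradient estimate.\<close>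
  define good where "good d c x \<longleftrightarrow> (\<exists>a\<in>A. \<exists>p. \<forall>y\<in>ball x0 d.
        p0 * l (y, a) + p \<bullet> f (y, a) \<le> - c \<and> U y \<le> U x + p \<bullet> (y - x) + 2 * R * (norm (y - x))\<^sup>2)"
    for d c x
  define d where "d k = min (\<rho> / 2) (e k)" for k
  have d: "0 < d k" "d k \<le> e k" "ball x0 (d k) \<subseteq> ball x0 (\<rho> / 2)" "ball x0 (d k) \<subseteq> ball x0 \<rho>" for k
    using \<rho> e[of k] by (auto simp: d_def)
  have "\<exists>k. \<forall>x\<in>ball x0 (d k). good (d k) (e k) x"
  proof (rule ccontr)
    assume "\<nexists>k. \<forall>x\<in>ball x0 (d k). good (d k) (e k) x"
    then obtain X where X: "\<And>k. X k \<in> ball x0 (d k)" "\<And>k. \<not> good (d k) (e k) (X k)" by metis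
    have "\<exists>p y g. (\<forall>w\<in>ball x0 \<rho>. U w \<le> U (X k) + p \<bullet> (w - X k) + 2 * R * (norm (w - X k))\<^sup>2)
        \<and> dist y (X k) < e k \<and> y \<in> ball x0 \<rho> \<and> y \<noteq> x0 \<and> GDERIV U y :> g
        \<and> norm g \<le> 8 * B / \<rho> + R * \<rho> \<and> norm (g - p) < e k" for k
    proof -
      have "X k \<in> ball x0 (\<rho> / 2)" using X(1) d(3) by blast
      then show ?thesis
        using semiconcave_supergradient_approx[OF sc less_imp_le[OF R] cont B _ e[of k]] by metis
    qed
    then obtain P Y G where P: "\<And>k w. w \<in> ball x0 \<rho> \<Longrightarrow> U w \<le> U (X k) + P k \<bullet> (w - X k) + 2 * R * (norm (w - X k))\<^sup>2"
      and Y: "\<And>k. dist (Y k) (X k) < e k" "\<And>k. Y k \<in> ball x0 \<rho>" "\<And>k. Y k \<noteq> x0" "\<And>k. GDERIV U (Y k) :> G k"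
      and G: "\<And>k. norm (G k) \<le> 8 * B / \<rho> + R * \<rho>" "\<And>k. norm (G k - P k) < e k" by metis
    have Xlim: "X \<longlonglongrightarrow> x0"
    proof (rule metric_tendsto_imp_tendsto[OF elim], intro always_eventually allI)
      fix k show "dist (X k) x0 \<le> dist (e k) 0"
        using X(1)[of k] d(2)[of k] e[of k] by (simp add: dist_commute)
    qed
    have small: "(\<lambda>k. h k) \<longlonglongrightarrow> 0" if "\<And>k. norm (h k) \<le> e k" for h :: "nat \<Rightarrow> real^'n"
      by (rule tendsto_0_le[OF elim, where K=1]) (use that e in \<open>auto intro!: always_eventually simp: less_imp_le\<close>)
    have "(\<lambda>k. Y k - X k) \<longlonglongrightarrow> 0" using Y(1) by (intro small) (simp add: dist_norm less_imp_le)
    from tendsto_add[OF this Xlim] have Ylim: "Y \<longlonglongrightarrow> x0" by simp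
    have "bounded (range G)" using G by (auto simp: bounded_iff)
    then obtain p \<sigma> where \<sigma>: "strict_mono (\<sigma> :: nat \<Rightarrow> nat)" and Gp: "(\<lambda>k. G (\<sigma> k)) \<longlonglongrightarrow> p"
      using bounded_imp_convergent_subsequence unfolding o_def by blast
    have subseq: "(\<lambda>k. h (\<sigma> k)) \<longlonglongrightarrow> L" if "h \<longlonglongrightarrow> L" for h :: "nat \<Rightarrow> real^'n" and L
      using LIMSEQ_subseq_LIMSEQ[OF that \<sigma>] by (simp add: o_def)
    have "(\<lambda>k. P k - G k) \<longlonglongrightarrow> 0"
      using G(2) by (intro small) (simp add: norm_minus_commute less_imp_le)
    from tendsto_add[OF subseq[OF this] Gp] have Pp: "(\<lambda>k. P (\<sigma> k)) \<longlonglongrightarrow> p" by simp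
    have "p \<in> limiting_gradient (- C) U x0"
      unfolding limiting_gradient_def mem_Collect_eq
      using Y sub' Gp subseq[OF Ylim]
      by (intro exI[of _ "\<lambda>k. Y (\<sigma> k)"] exI[of _ "\<lambda>k. G (\<sigma> k)"]) blast
    then have "hamiltonian A f l x0 p0 p < 0"
      using mrf x0 by (auto simp: minimum_restraint_function_with_def)
    then obtain a where a: "a \<in> A" and neg: "p0 * l (x0, a) + p \<bullet> f (x0, a) < 0"
      unfolding hamiltonian_def by (auto simp: INF_less_iff)
    \<comment> \<open>The quadratic estimate holds, so failure at \<open>X k\<close> is failure of the Hamiltonian inequality.\<close>
    have "\<exists>y\<in>ball x0 (d k). - e k < p0 * l (y, a) + P k \<bullet> f (y, a)" for k
      using X(2)[of k] a P d(4)[of k] unfolding good_def by (meson in_mono not_le)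
    then obtain W where W: "\<And>k. W k \<in> ball x0 (d k)" "\<And>k. - e k < p0 * l (W k, a) + P k \<bullet> f (W k, a)"
      by metis
    have Wlim: "W \<longlonglongrightarrow> x0"
    proof (rule metric_tendsto_imp_tendsto[OF elim], intro always_eventually allI)
      fix k show "dist (W k) x0 \<le> dist (e k) 0"
        using W(1)[of k] d(2)[of k] e[of k] by (simp add: dist_commute)
    qed
    have WC: "\<forall>\<^sub>F k in sequentially. W (\<sigma> k) \<in> - C" using W(1) d(4) sub' by (intro always_eventually allI) blast
    have "(\<lambda>k. p0 * l (W (\<sigma> k), a) + P (\<sigma> k) \<bullet> f (W (\<sigma> k), a)) \<longlonglongrightarrow> p0 * l (x0, a) + p \<bullet> f (x0, a)"
      by (intro tendsto_intros Pp
          continuous_on_tendsto_compose[OF cont_l_control[OF a order_refl] subseq[OF Wlim] x0 WC]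
          continuous_on_tendsto_compose[OF cont_f_control[OF a order_refl] subseq[OF Wlim] x0 WC])
    moreover have "(\<lambda>k. - e (\<sigma> k)) \<longlonglongrightarrow> - 0"
      using LIMSEQ_subseq_LIMSEQ[OF elim \<sigma>] unfolding o_def by (rule tendsto_minus)
    ultimately have "- 0 \<le> p0 * l (x0, a) + p \<bullet> f (x0, a)"
      using W(2) by (intro LIMSEQ_le[of "\<lambda>k. - e (\<sigma> k)"]) (auto simp: less_imp_le)
    with neg show False by simp
  qed
  then obtain k where "\<And>x. x \<in> ball x0 (d k) \<Longrightarrow> good (d k) (e k) x" by blast
  then show ?thesis
    using that[of "d k" "e k" "2 * R"] d e R sub' unfolding good_def by (meson less_imp_le subset_trans mult_nonneg_nonneg zero_le_numeral)
qed

text \<open>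
  Using the single number \<open>c\<close> for the length of the arc and for the rate of decrease leaves one quantity to be bounded below on compact sets. The start time \<open>s\<close> is arbitrary so that
  arcs can be concatenated without translating time.
\<close>

definition descent_arc :: "real \<Rightarrow> real^'n \<Rightarrow> real \<Rightarrow> real^'m \<Rightarrow> (real \<Rightarrow> real^'n) \<Rightarrow> bool" where
  "descent_arc c x s a z \<longleftrightarrow> a \<in> A \<and> z s = x \<and> (\<forall>t\<in>{s..s + c}. z t \<in> - C
     \<and> (z has_vector_derivative f (z t, a)) (at t within {s..s + c})
     \<and> U (z t) + p0 * integral {s..t} (\<lambda>r. l (z r, a)) \<le> U x - c * (t - s))"

lemma descent_arc_shorten:
  assumes "descent_arc c x s a z" "c' \<le> c"
  shows "descent_arc c' x s a z"
  unfolding descent_arc_def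
proof (intro conjI ballI)
  fix t assume t: "t \<in> {s..s + c'}"
  then have "(z has_vector_derivative f (z t, a)) (at t within {s..s + c})"
    using assms unfolding descent_arc_def by auto
  then show "(z has_vector_derivative f (z t, a)) (at t within {s..s + c'})"
    by (rule has_vector_derivative_within_subset) (use assms in auto)
  have "c' * (t - s) \<le> c * (t - s)" using t assms by (intro mult_right_mono) auto
  moreover have "U (z t) + p0 * integral {s..t} (\<lambda>r. l (z r, a)) \<le> U x - c * (t - s)"
    using assms t unfolding descent_arc_def by auto
  ultimately show "U (z t) + p0 * integral {s..t} (\<lambda>r. l (z r, a)) \<le> U x - c' * (t - s)" by linarith
qed (use assms in \<open>auto simp: descent_arc_def\<close>)

text \<open>
  Solve the equation with the constant control \<open>a\<close> given by \<open>uniform_descent_direction\<close>. The proximal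
  inequality bounds the increment of \<open>U\<close> by \<open>p \<bullet> (z t - x) + R |z t - x|\<^sup>2\<close>. Writing \<open>p \<bullet> (z t - x)\<close>
  as the integral of \<open>p \<bullet> f (z r, a)\<close> and adding the cost, the integrand is at most \<open>- c\<close>, while the
  quadratic term is of order \<open>(t - s)\<^sup>2\<close>; for short times half of the rate \<open>c\<close> survives.
\<close>

lemma descent_arcs_near:
  assumes x0: "x0 \<in> - C"
  obtains d c where "0 < d" "0 < c" "\<And>x s. x \<in> ball x0 d \<Longrightarrow> \<exists>a z. descent_arc c x s a z"
proof -
  obtain d c R where d: "0 < d" and c: "0 < c" and R: "0 \<le> R" and sub: "ball x0 d \<subseteq> - C"
    and dir: "\<And>x. x \<in> ball x0 d \<Longrightarrow> \<exists>a\<in>A. \<exists>p. \<forall>y\<in>ball x0 d.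
        p0 * l (y, a) + p \<bullet> f (y, a) \<le> - c \<and> U y \<le> U x + p \<bullet> (y - x) + R * (norm (y - x))\<^sup>2"
    using uniform_descent_direction[OF x0] by blast
  define K where "K = cball x0 (d / 2)"
  have K: "K \<subseteq> ball x0 d" "compact K" "convex K" "K \<noteq> {}"
    using d by (auto simp: K_def)
  have KC: "K \<subseteq> - C" using K(1) sub by blast
  have "compact (f ` (K \<times> A))"
    using K KC compact_A by (intro compact_continuous_image continuous_on_subset[OF cont_f] compact_Times) auto
  from compact_imp_bounded[OF this] obtain M0 where "\<forall>v\<in>f ` (K \<times> A). norm v \<le> M0"
    unfolding bounded_iff by blast
  then have M0: "\<And>y a. y \<in> K \<Longrightarrow> a \<in> A \<Longrightarrow> norm (f (y, a)) \<le> M0" by blast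
  define M where "M = max 1 M0"
  have M: "0 < M" "\<And>y a. y \<in> K \<Longrightarrow> a \<in> A \<Longrightarrow> norm (f (y, a)) \<le> M"
    using M0 by (auto simp: M_def le_max_iff_disj)
  \<comment> \<open>The first bound keeps the arc in \<open>K\<close>, the second limits the quadratic error to \<open>c / 2\<close> times
    the elapsed time, and the third makes \<open>\<tau>\<close> a rate that is still achieved.\<close>
  define \<tau> where "\<tau> = Min {d / (4 * M), c / (2 * (R * M\<^sup>2 + 1)), c / 2}"
  have RM: "0 \<le> R * M\<^sup>2" using R by simp
  have \<tau>: "0 < \<tau>" using d c M RM by (simp add: \<tau>_def)
  have "\<tau> \<le> d / (4 * M)" "\<tau> \<le> c / (2 * (R * M\<^sup>2 + 1))" and \<tau>3: "\<tau> \<le> c / 2"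
    unfolding \<tau>_def by (rule Min_le; simp)+
  then have \<tau>1: "M * \<tau> \<le> d / 4" and "(R * M\<^sup>2 + 1) * \<tau> \<le> c / 2"
    using M RM by (auto simp: field_simps)
  moreover have "R * M\<^sup>2 * \<tau> \<le> (R * M\<^sup>2 + 1) * \<tau>" using \<tau> by (intro mult_right_mono) auto
  ultimately have \<tau>2: "R * M\<^sup>2 * \<tau> \<le> c / 2" by linarith
  have "\<exists>a z. descent_arc \<tau> x s a z" if x: "x \<in> ball x0 (d / 4)" for x s
  proof -
    have "x \<in> ball x0 d" using x d by auto
    then obtain a p where a: "a \<in> A" and ap: "\<And>y. y \<in> ball x0 d \<Longrightarrow> p0 * l (y, a) + p \<bullet> f (y, a) \<le> - c"
      and sup: "\<And>y. y \<in> ball x0 d \<Longrightarrow> U y \<le> U x + p \<bullet> (y - x) + R * (norm (y - x))\<^sup>2"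
      using dir by blast
    \<comment> \<open>The projection onto \<open>K\<close> extends the vector field to a bounded one on the whole space.\<close>
    define \<phi> where "\<phi> y = f (closest_point K y, a)" for y
    have cpK: "closest_point K y \<in> K" for y
      using K by (intro closest_point_in_set compact_imp_closed)
    have "continuous_on UNIV \<phi>" unfolding \<phi>_def
      by (rule continuous_on_compose2[OF cont_f_control[OF a KC] continuous_on_closest_point])
         (use K cpK in \<open>auto intro: compact_imp_closed\<close>)
    moreover have "norm (\<phi> y) \<le> M" for y unfolding \<phi>_def using M(2) cpK a by blast
    ultimately obtain z where zs: "z s = x"
      and z': "\<And>t. t \<in> {s..s + \<tau>} \<Longrightarrow> (z has_vector_derivative \<phi> (z t)) (at t within {s..s + \<tau>})"
      using peano[of \<phi> M s x \<tau>] by metis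
    have lip: "M-lipschitz_on {s..s + \<tau>} z"
      by (rule vector_derivative_bound_lipschitz[OF z']) (use \<open>\<And>y. norm (\<phi> y) \<le> M\<close> M in auto)
    have zx: "norm (z t - x) \<le> M * (t - s)" if "t \<in> {s..s + \<tau>}" for t
      using lipschitz_onD[OF lip that, of s] \<tau> that zs by (simp add: dist_norm)
    have zK: "z t \<in> K" if "t \<in> {s..s + \<tau>}" for t
    proof -
      have "M * (t - s) \<le> M * \<tau>" using that M by (intro mult_left_mono) auto
      then have "dist x (z t) \<le> d / 4" using zx[OF that] \<tau>1 by (simp add: dist_norm norm_minus_commute)
      then show ?thesis using x dist_triangle[of x0 "z t" x] by (simp add: K_def)
    qed
    have zf: "\<phi> (z t) = f (z t, a)" if "t \<in> {s..s + \<tau>}" for t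
      using closest_point_self[OF zK[OF that]] by (simp add: \<phi>_def)
    have contz: "continuous_on {s..s + \<tau>} z" using lip by (rule lipschitz_on_continuous_on)
    have "descent_arc \<tau> x s a z"
      unfolding descent_arc_def
    proof (intro conjI ballI a zs)
      fix t assume t: "t \<in> {s..s + \<tau>}"
      show "z t \<in> - C" using zK[OF t] KC by auto
      show "(z has_vector_derivative f (z t, a)) (at t within {s..s + \<tau>})"
        using z'[OF t] zf[OF t] by simp
      have subt: "{s..t} \<subseteq> {s..s + \<tau>}" using t by auto
      have "((\<lambda>r. f (z r, a)) has_integral (z t - z s)) {s..t}"
      proof (rule fundamental_theorem_of_calculus)
        fix r assume r: "r \<in> {s..t}"
        then have "r \<in> {s..s + \<tau>}" using subt by auto
        from z'[OF this] zf[OF this] show "(z has_vector_derivative f (z r, a)) (at r within {s..t})"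
          using has_vector_derivative_within_subset[OF _ subt] by metis
      qed (use t in auto)
      from has_integral_linear[OF this bounded_linear_inner_right[of p]]
      have I1: "((\<lambda>r. p \<bullet> f (z r, a)) has_integral (p \<bullet> (z t - x))) {s..t}" by (simp add: o_def zs)
      have "continuous_on {s..t} (\<lambda>r. l (z r, a))"
        by (rule continuous_on_compose2[OF cont_l_control[OF a KC] continuous_on_subset[OF contz subt]])
           (use zK subt in auto)
      then have "((\<lambda>r. l (z r, a)) has_integral integral {s..t} (\<lambda>r. l (z r, a))) {s..t}"
        by (intro integrable_integral integrable_continuous_real)
      from has_integral_add[OF has_integral_mult_right[OF this, of p0] I1]
      have I2: "((\<lambda>r. p0 * l (z r, a) + p \<bullet> f (z r, a)) has_integral
          p0 * integral {s..t} (\<lambda>r. l (z r, a)) + p \<bullet> (z t - x)) {s..t}" .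
      have I3: "((\<lambda>r. - c) has_integral (- c * (t - s))) {s..t}"
        using has_integral_const_real[of "- c" s t] t by (simp add: mult.commute)
      have "p0 * integral {s..t} (\<lambda>r. l (z r, a)) + p \<bullet> (z t - x) \<le> - c * (t - s)"
        by (rule has_integral_le[OF I2 I3]) (use ap zK K subt in blast)
      moreover have "U (z t) \<le> U x + p \<bullet> (z t - x) + R * (norm (z t - x))\<^sup>2"
        using sup zK[OF t] K by blast
      moreover have "R * (norm (z t - x))\<^sup>2 \<le> c / 2 * (t - s)"
      proof -
        have "R * (norm (z t - x))\<^sup>2 \<le> R * (M * (t - s))\<^sup>2"
          using zx[OF t] R by (intro mult_left_mono power_mono) auto
        also have "\<dots> = R * M\<^sup>2 * (t - s) * (t - s)" by (simp add: power2_eq_square)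
        also have "\<dots> \<le> R * M\<^sup>2 * \<tau> * (t - s)"
          using t RM by (intro mult_right_mono mult_left_mono) auto
        also have "\<dots> \<le> c / 2 * (t - s)" using \<tau>2 t by (intro mult_right_mono) auto
        finally show ?thesis .
      qed
      moreover have "\<tau> * (t - s) \<le> c / 2 * (t - s)" using \<tau>3 t by (intro mult_right_mono) auto
      ultimately show "U (z t) + p0 * integral {s..t} (\<lambda>r. l (z r, a)) \<le> U x - \<tau> * (t - s)"
        by (simp add: algebra_simps)
    qed
    then show ?thesis by blast
  qed
  then show ?thesis using that[of "d / 4" \<tau>] d \<tau> by auto
qed

lemma descent_arcs_on_compact:
  assumes K: "compact K" "K \<subseteq> - C"
  obtains c where "0 < c" "\<And>x s. x \<in> K \<Longrightarrow> \<exists>a z. descent_arc c x s a z"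
proof -
  have "\<forall>x0\<in>K. \<exists>d c. 0 < d \<and> 0 < c \<and> (\<forall>x s. x \<in> ball x0 d \<longrightarrow> (\<exists>a z. descent_arc c x s a z))"
    using descent_arcs_near K(2) by (metis subsetD)
  then obtain D \<gamma> where D: "\<And>x0. x0 \<in> K \<Longrightarrow> 0 < D x0" and \<gamma>: "\<And>x0. x0 \<in> K \<Longrightarrow> 0 < \<gamma> x0"
    and arcs: "\<And>x0 x s. x0 \<in> K \<Longrightarrow> x \<in> ball x0 (D x0) \<Longrightarrow> \<exists>a z. descent_arc (\<gamma> x0) x s a z"
    by metis
  obtain F where F: "F \<subseteq> K" "finite F" "K \<subseteq> (\<Union>x0\<in>F. ball x0 (D x0))"
  proof (rule compactE_image[OF K(1), of K "\<lambda>x0. ball x0 (D x0)"])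
    show "K \<subseteq> (\<Union>x0\<in>K. ball x0 (D x0))" using D by force
  qed auto
  define c where "c = Min (insert 1 (\<gamma> ` F))"
  have "0 < c" using F \<gamma> by (auto simp: c_def)
  moreover have "\<exists>a z. descent_arc c x s a z" if x: "x \<in> K" for x s
  proof -
    obtain x0 where x0: "x0 \<in> F" "x \<in> ball x0 (D x0)" using F(3) x by blast
    then obtain a z where "descent_arc (\<gamma> x0) x s a z" using arcs F by blast
    moreover have "c \<le> \<gamma> x0" using F x0 by (auto simp: c_def)
    ultimately show ?thesis using descent_arc_shorten by blast
  qed
  ultimately show ?thesis using that by blast
qed

text \<open>
  Properness gives compactness in the closure of the complement; the condition \<open>U x \<ge> a > 0\<close> then
  excludes the boundary.
\<close>

lemma compact_level_band:
  assumes "0 < a"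
  shows "compact {x \<in> - C. U x \<in> {a..b}}"
proof -
  have "compact {a..b} \<and> {a..b} \<subseteq> {0..}" using assms by auto
  then have "compact {x \<in> closure (- C). U x \<in> {a..b}}"
    using mrf unfolding minimum_restraint_function_with_def proper_fun_def by blast
  moreover have "{x \<in> closure (- C). U x \<in> {a..b}} = {x \<in> - C. U x \<in> {a..b}}"
    using closure_compl_cases assms closure_subset[of "- C"] by fastforce
  ultimately show ?thesis by simp
qed

text \<open>
  The bands \<open>1 / (j + 1) \<le> U \<le> j + 1\<close> exhaust the complement of the target. Taking at level \<open>u\<close> the least
  rate among all bands up to one that contains \<open>u\<close> gives a rate \<open>\<Gamma>\<close> that depends on the
  level only and is bounded below on compact intervals of positive levels.
\<close>

lemma descent_rate_exists:
  obtains \<Gamma> where "\<And>u. 0 < \<Gamma> u" "\<And>a b. 0 < a \<Longrightarrow> \<exists>c>0. \<forall>u\<in>{a..b}. c \<le> \<Gamma> u"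
    "\<And>x s. x \<in> - C \<Longrightarrow> \<exists>a z. descent_arc (\<Gamma> (U x)) x s a z"
proof -
  define K where "K j = {x \<in> - C. U x \<in> {1 / real (Suc j)..real (Suc j)}}" for j
  have "\<exists>c>0. \<forall>x s. x \<in> K j \<longrightarrow> (\<exists>a z. descent_arc c x s a z)" for j
    using descent_arcs_on_compact[of "K j"] compact_level_band[of "1 / real (Suc j)" "real (Suc j)"]
    unfolding K_def by (metis (no_types, lifting) mem_Collect_eq of_nat_0_less_iff subsetI zero_less_Suc zero_less_divide_1_iff)
  then obtain c where c: "\<And>j. 0 < c j" "\<And>j x s. x \<in> K j \<Longrightarrow> \<exists>a z. descent_arc (c j) x s a z"
    by metis
  define \<nu> where "\<nu> u = nat \<lceil>max u (1 / u)\<rceil>" for u :: real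
  define \<Gamma> where "\<Gamma> u = Min (c ` {..\<nu> u})" for u
  have \<nu>: "x \<in> K (\<nu> (U x))" if "x \<in> - C" for x
  proof -
    have "max (U x) (1 / U x) \<le> real (Suc (\<nu> (U x)))" unfolding \<nu>_def by linarith
    then show ?thesis using that U_pos[OF that] by (auto simp: K_def field_simps)
  qed
  have "\<exists>c>0. \<forall>u\<in>{a..b}. c \<le> \<Gamma> u" if "0 < a" for a b
  proof (intro exI[of _ "Min (c ` {..nat \<lceil>max b (1 / a)\<rceil>})"] conjI ballI)
    fix u assume u: "u \<in> {a..b}"
    have "max u (1 / u) \<le> max b (1 / a)" using u that by (intro max.mono divide_left_mono) auto
    then have "\<nu> u \<le> nat \<lceil>max b (1 / a)\<rceil>" unfolding \<nu>_def by (intro nat_mono ceiling_mono)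
    then show "Min (c ` {..nat \<lceil>max b (1 / a)\<rceil>}) \<le> \<Gamma> u"
      unfolding \<Gamma>_def by (intro Min_antimono) auto
  qed (use c in auto)
  moreover have "\<exists>a z. descent_arc (\<Gamma> (U x)) x s a z" if x: "x \<in> - C" for x s
  proof -
    have "\<Gamma> (U x) \<le> c (\<nu> (U x))" unfolding \<Gamma>_def by (intro Min_le) auto
    then show ?thesis using c(2)[OF \<nu>[OF x]] descent_arc_shorten by blast
  qed
  moreover have "0 < \<Gamma> u" for u using c by (auto simp: \<Gamma>_def)
  ultimately show ?thesis using that by blast
qed

end

section \<open>Concatenation of infinitely many arcs\<close>

lemma lipschitz_imp_abs_continuous:
  fixes g :: "real \<Rightarrow> 'a::real_normed_vector"
  assumes "L-lipschitz_on S g"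
  shows "abs_continuous_on S g"
  unfolding abs_continuous_on_def
proof (intro allI impI)
  fix \<epsilon> :: real assume \<epsilon>: "0 < \<epsilon>"
  have L: "0 \<le> L" using assms by (rule lipschitz_on_nonneg)
  show "\<exists>\<delta>>0. \<forall>k (a::nat \<Rightarrow> real) b. (\<forall>i<k. a i \<le> b i \<and> {a i..b i} \<subseteq> S)
      \<and> disjoint_family_on (\<lambda>i. {a i<..<b i}) {..<k} \<and> (\<Sum>i<k. b i - a i) < \<delta>
      \<longrightarrow> (\<Sum>i<k. norm (g (b i) - g (a i))) < \<epsilon>"
  proof (intro exI[of _ "\<epsilon> / (L + 1)"] conjI allI impI)
    fix k :: nat and a b :: "nat \<Rightarrow> real"
    assume H: "(\<forall>i<k. a i \<le> b i \<and> {a i..b i} \<subseteq> S)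
      \<and> disjoint_family_on (\<lambda>i. {a i<..<b i}) {..<k} \<and> (\<Sum>i<k. b i - a i) < \<epsilon> / (L + 1)"
    have "(\<Sum>i<k. norm (g (b i) - g (a i))) \<le> (\<Sum>i<k. L * (b i - a i))"
    proof (rule sum_mono)
      fix i assume "i \<in> {..<k}"
      then have "a i \<le> b i" "{a i..b i} \<subseteq> S" using H by auto
      then have "a i \<in> S" "b i \<in> S" by auto
      from lipschitz_onD[OF assms this(2,1)] \<open>a i \<le> b i\<close>
      show "norm (g (b i) - g (a i)) \<le> L * (b i - a i)" by (simp add: dist_norm)
    qed
    also have "\<dots> = L * (\<Sum>i<k. b i - a i)" by (simp add: sum_distrib_left)
    also have "\<dots> \<le> L * (\<epsilon> / (L + 1))" using H L by (intro mult_left_mono) auto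
    also have "\<dots> < \<epsilon>" using L \<epsilon> by (simp add: field_simps)
    finally show "(\<Sum>i<k. norm (g (b i) - g (a i))) < \<epsilon>" .
  qed (use \<epsilon> L in auto)
qed

definition piece_index :: "(nat \<Rightarrow> real) \<Rightarrow> real \<Rightarrow> nat" where
  "piece_index t r = (LEAST k. r < t (Suc k))"

lemma piece_index_eq:
  assumes "strict_mono t" "t k \<le> r" "r < t (Suc k)"
  shows "piece_index t r = k"
  unfolding piece_index_def
proof (rule Least_equality)
  fix j assume "r < t (Suc j)"
  then have "t k < t (Suc j)" using assms by linarith
  then show "k \<le> j" using assms(1) by (simp add: strict_mono_less)
qed (use assms in auto)

lemma time_dom_SUP_eq_UN:
  assumes t: "strict_mono t" "t 0 = 0"
  shows "time_dom (SUP k. ereal (t k)) = (\<Union>k. {t k..<t (Suc k)})"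
proof (intro set_eqI iffI)
  fix r assume "r \<in> time_dom (SUP k. ereal (t k))"
  then have r: "0 \<le> r" "\<exists>k. r < t k" by (auto simp: time_dom_def less_SUP_iff)
  define k where "k = (LEAST k. r < t k)"
  have k: "r < t k" unfolding k_def using r(2) by (rule LeastI_ex)
  have "k \<noteq> 0" using k t(2) r(1) by (metis not_le)
  then obtain j where j: "k = Suc j" using not0_implies_Suc by blast
  have "\<not> r < t j" using j not_less_Least[of j "\<lambda>k. r < t k"] by (simp add: k_def[symmetric])
  then have "r \<in> {t j..<t (Suc j)}" using k j by auto
  then show "r \<in> (\<Union>k. {t k..<t (Suc k)})" by blast
next
  fix r assume "r \<in> (\<Union>k. {t k..<t (Suc k)})"
  then obtain k where k: "t k \<le> r" "r < t (Suc k)" by auto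
  have "t 0 \<le> t k" using t(1) by (simp add: strict_mono_less_eq)
  then show "r \<in> time_dom (SUP k. ereal (t k))"
    using k t(2) by (auto simp: time_dom_def less_SUP_iff)
qed

text \<open>
  The switching times \<open>t k\<close> may accumulate at a finite time or tend to infinity, and the arcs need not
  have uniformly bounded speed; the supremum of the switching times is the terminal time in
  either case.
\<close>

locale concatenation =
  fixes t :: "nat \<Rightarrow> real" and X :: "nat \<Rightarrow> real^'n" and Z :: "nat \<Rightarrow> real \<Rightarrow> real^'n"
    and a :: "nat \<Rightarrow> real^'m" and f :: "(real^'n) \<times> (real^'m) \<Rightarrow> real^'n" and C A
  assumes mono: "strict_mono t" and t0: "t 0 = 0"
    and start: "Z k (t k) = X k" and finish: "Z k (t (Suc k)) = X (Suc k)"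
    and control: "a k \<in> A"
    and outside: "r \<in> {t k..t (Suc k)} \<Longrightarrow> Z k r \<in> - C"
    and ode: "r \<in> {t k..t (Suc k)} \<Longrightarrow>
      (Z k has_vector_derivative f (Z k r, a k)) (at r within {t k..t (Suc k)})"
    and cont_f: "continuous_on ((- C) \<times> A) f"
begin

definition z where "z r = Z (piece_index t r) r"
definition \<alpha> where "\<alpha> r = a (piece_index t r)"
definition T where "T = (SUP k. ereal (t k))"

lemma t_less: "t k < t (Suc k)"
  using mono by (simp add: strict_mono_less)

lemma time_dom_T: "time_dom T = (\<Union>k. {t k..<t (Suc k)})"
  unfolding T_def using mono t0 by (rule time_dom_SUP_eq_UN)

lemma z_eq: "r \<in> {t k..<t (Suc k)} \<Longrightarrow> z r = Z k r"
  using piece_index_eq[OF mono, of k r] by (simp add: z_def)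

lemma \<alpha>_eq: "r \<in> {t k..<t (Suc k)} \<Longrightarrow> \<alpha> r = a k"
  using piece_index_eq[OF mono, of k r] by (simp add: \<alpha>_def)

lemma z_closed: "r \<in> {t k..t (Suc k)} \<Longrightarrow> z r = Z k r"
proof (cases "r = t (Suc k)")
  case True
  then show ?thesis using z_eq[of r "Suc k"] t_less start finish by simp
qed (auto intro: z_eq)

lemma Z_continuous: "continuous_on {t k..t (Suc k)} (Z k)"
  using ode continuous_on_eq_continuous_within has_vector_derivative_continuous by blast

text \<open>
  The Lipschitz constant depends on \<open>N\<close>: no bound on \<open>f\<close> near the target is available.
\<close>

lemma z_lipschitz: "\<exists>L. L-lipschitz_on {0..t N} z"
proof (induction N)
  case 0
  have "0-lipschitz_on {0..t 0} z" by (rule lipschitz_onI) (auto simp: t0)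
  then show ?case ..
next
  case (Suc k)
  then obtain L where L: "L-lipschitz_on {0..t k} z" by blast
  have "continuous_on {t k..t (Suc k)} (\<lambda>r. f (Z k r, a k))"
    by (rule continuous_on_compose2[OF cont_f]) (use outside control in \<open>auto intro!: continuous_intros Z_continuous\<close>)
  from compact_imp_bounded[OF compact_continuous_image[OF this compact_Icc]]
  obtain B where "\<forall>v\<in>(\<lambda>r. f (Z k r, a k)) ` {t k..t (Suc k)}. norm v \<le> B"
    unfolding bounded_iff by blast
  then have "(max 0 B)-lipschitz_on {t k..t (Suc k)} (Z k)"
    by (intro vector_derivative_bound_lipschitz[OF ode]) (auto simp: le_max_iff_disj)
  then have "(max 0 B)-lipschitz_on {t k..t (Suc k)} z"
    by (rule lipschitz_on_transform) (simp add: z_closed)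
  from lipschitz_on_concat_max[OF L this] show ?case by auto
qed

lemma z_locally_abs_continuous: "locally_abs_continuous_on (time_dom T) z"
  unfolding locally_abs_continuous_on_def
proof (intro allI impI)
  fix u v assume sub: "{u..v} \<subseteq> time_dom T"
  have "\<exists>N. {u..v} \<subseteq> {0..t N}"
  proof (cases "u \<le> v")
    case True
    then have "u \<in> time_dom T" "v \<in> time_dom T" using sub by auto
    then have "0 \<le> u" and "\<exists>k. v < t k" unfolding time_dom_def T_def by (auto simp: less_SUP_iff)
    then obtain k where "v < t k" by blast
    with \<open>0 \<le> u\<close> have "{u..v} \<subseteq> {0..t k}" by auto
    then show ?thesis ..
  qed auto
  then show "abs_continuous_on {u..v} z"
    using z_lipschitz lipschitz_on_subset lipschitz_imp_abs_continuous by metis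
qed

lemma \<alpha>_measurable: "\<alpha> \<in> borel_measurable (restrict_space borel S)"
proof -
  have "piece_index t \<in> measurable borel (count_space UNIV)"
    unfolding piece_index_def[abs_def] by measurable
  then have "(\<lambda>r. a (piece_index t r)) \<in> borel_measurable borel"
    by (rule measurable_compose) simp
  then show ?thesis unfolding \<alpha>_def[abs_def] by (rule measurable_restrict_space1)
qed

text \<open>
  The differential equation may fail only at the countably many switching times.
\<close>

lemma z_ode: "AE r in lborel. r \<in> time_dom T \<longrightarrow>
    (z has_vector_derivative f (z r, \<alpha> r)) (at r within time_dom T)"
proof -
  have "AE r in lborel. r \<notin> range t"
    by (intro AE_not_in countable_imp_null_set_lborel) auto
  then show ?thesis
  proof (rule AE_mp, intro AE_I2 impI)
    fix r assume nr: "r \<notin> range t" and "r \<in> time_dom T"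
    then obtain k where k: "r \<in> {t k..<t (Suc k)}" unfolding time_dom_T by blast
    then have r: "t k < r" "r < t (Suc k)" using nr by (auto simp: order.order_iff_strict)
    have "(Z k has_vector_derivative f (Z k r, a k)) (at r within {t k..t (Suc k)})"
      using ode r by simp
    then have "(Z k has_vector_derivative f (z r, \<alpha> r)) (at r)"
      using at_within_Icc_at[OF r] z_eq[OF k] \<alpha>_eq[OF k] by simp
    then have "(z has_vector_derivative f (z r, \<alpha> r)) (at r)"
      by (rule has_vector_derivative_transform_within_open[of _ _ _ "{t k<..<t (Suc k)}"])
         (use r z_eq[symmetric] in auto)
    then show "(z has_vector_derivative f (z r, \<alpha> r)) (at r within time_dom T)"
      by (rule has_vector_derivative_at_within)
  qed
qed

lemma T_pos: "0 < T"
proof -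
  have "(0::ereal) < ereal (t 1)" using t_less[of 0] t0 by simp
  also have "\<dots> \<le> T" unfolding T_def by (intro SUP_upper) simp
  finally show ?thesis .
qed

lemma z_admissible:
  assumes lim: "\<And>e. 0 < e \<Longrightarrow> \<exists>N. \<forall>k\<ge>N. \<forall>r\<in>{t k..<t (Suc k)}. infdist (Z k r) C < e"
  shows "admissible C A f (X 0) T z \<alpha>"
  unfolding admissible_def
proof (intro conjI ballI T_pos \<alpha>_measurable z_locally_abs_continuous z_ode)
  fix r assume "r \<in> time_dom T"
  then obtain k where k: "r \<in> {t k..<t (Suc k)}" unfolding time_dom_T by blast
  then show "z r \<in> - C" "\<alpha> r \<in> A" using z_eq[OF k] \<alpha>_eq[OF k] outside[of r k] control by auto
next
  show "z 0 = X 0" using z_eq[of 0 0] t_less[of 0] t0 start[of 0] by simp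
next
  show "((\<lambda>r. infdist (z (real_of_ereal r)) C) \<longlongrightarrow> 0) (at_left T)"
  proof (rule tendstoI)
    fix e :: real assume "0 < e"
    then obtain N where N: "\<And>k r. k \<ge> N \<Longrightarrow> r \<in> {t k..<t (Suc k)} \<Longrightarrow> infdist (Z k r) C < e"
      using lim by blast
    have tN: "ereal (t N) < T"
    proof -
      have "ereal (t N) < ereal (t (Suc N))" using t_less by simp
      also have "\<dots> \<le> T" unfolding T_def by (intro SUP_upper) simp
      finally show ?thesis .
    qed
    have "dist (infdist (z (real_of_ereal r)) C) 0 < e" if r: "ereal (t N) < r" "r < T" for r
    proof -
      obtain q where q: "r = ereal q" using r by (cases r) auto
      have "t 0 \<le> t N" using mono by (simp add: strict_mono_less_eq)
      then have "q \<in> time_dom T" using r q t0 by (auto simp: time_dom_def)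
      then obtain k where k: "q \<in> {t k..<t (Suc k)}" unfolding time_dom_T by blast
      then have "t N < t (Suc k)" using r q by auto
      then have "N \<le> k" using mono by (simp add: strict_mono_less)
      from N[OF this k] show ?thesis using z_eq[OF k] q by (simp add: infdist_nonneg)
    qed
    then show "\<forall>\<^sub>F r in at_left T. dist (infdist (z (real_of_ereal r)) C) 0 < e"
      unfolding eventually_at_left[OF tN] using tN by blast
  qed
qed

lemma z_cost_le:
  assumes l: "continuous_on ((- C) \<times> A) l" "\<And>x b. x \<in> - C \<Longrightarrow> b \<in> A \<Longrightarrow> 0 \<le> l (x, b)"
  shows "(\<integral>\<^sup>+ r\<in>time_dom T. ennreal (l (z r, \<alpha> r)) \<partial>lborel)
    \<le> (\<Sum>k. ennreal (integral {t k..t (Suc k)} (\<lambda>r. l (Z k r, a k))))"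
proof -
  define g where "g k r = ennreal (indicator {t k..<t (Suc k)} r *\<^sub>R l (Z k r, a k))" for k r
  have cont: "continuous_on {t k..t (Suc k)} (\<lambda>r. l (Z k r, a k))" for k
    by (rule continuous_on_compose2[OF l(1)]) (use outside control in \<open>auto intro!: continuous_intros Z_continuous\<close>)
  have meas: "g k \<in> borel_measurable lborel" for k
  proof -
    have "(\<lambda>r. indicator {t k..<t (Suc k)} r *\<^sub>R l (Z k r, a k)) \<in> borel_measurable borel"
      by (intro borel_measurable_continuous_on_indicator continuous_on_subset[OF cont]) auto
    then show ?thesis unfolding g_def[abs_def] by measurable
  qed
  have "ennreal (l (z r, \<alpha> r)) * indicator (time_dom T) r = (\<Sum>k. g k r)" for r
  proof (cases "r \<in> time_dom T")
    case True
    then obtain k where k: "r \<in> {t k..<t (Suc k)}" unfolding time_dom_T by blast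
    have "g j r = 0" if "j \<noteq> k" for j
    proof -
      have "r \<notin> {t j..<t (Suc j)}"
        using piece_index_eq[OF mono, of j r] piece_index_eq[OF mono, of k r] k that by auto
      then show ?thesis by (simp add: g_def)
    qed
    then have "(\<Sum>j. g j r) = (\<Sum>j\<in>{k}. g j r)" by (intro suminf_finite) auto
    then show ?thesis using True k z_eq[OF k] \<alpha>_eq[OF k] by (simp add: g_def)
  next
    case False
    then have "r \<notin> {t k..<t (Suc k)}" for k unfolding time_dom_T by blast
    then have "g k r = 0" for k by (simp add: g_def)
    then show ?thesis using False by simp
  qed
  then have "(\<integral>\<^sup>+ r\<in>time_dom T. ennreal (l (z r, \<alpha> r)) \<partial>lborel) = (\<integral>\<^sup>+ r. (\<Sum>k. g k r) \<partial>lborel)"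
    by simp
  also have "\<dots> = (\<Sum>k. \<integral>\<^sup>+ r. g k r \<partial>lborel)" using meas by (rule nn_integral_suminf)
  also have "\<dots> \<le> (\<Sum>k. ennreal (integral {t k..t (Suc k)} (\<lambda>r. l (Z k r, a k))))"
  proof (rule suminf_le)
    fix k
    have "(\<integral>\<^sup>+ r. g k r \<partial>lborel)
        \<le> (\<integral>\<^sup>+ r. ennreal (indicator {t k..t (Suc k)} r * l (Z k r, a k)) \<partial>lborel)"
      by (intro nn_integral_mono) (use l(2) outside control in \<open>auto simp: g_def indicator_def\<close>)
    also have "\<dots> = ennreal (integral {t k..t (Suc k)} (\<lambda>r. l (Z k r, a k)))"
    proof (rule nn_integral_has_integral_lebesgue)
      show "((\<lambda>r. l (Z k r, a k)) has_integral integral {t k..t (Suc k)} (\<lambda>r. l (Z k r, a k))) {t k..t (Suc k)}"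
        by (intro integrable_integral integrable_continuous_real cont)
    qed (use l(2) outside control in auto)
    finally show "(\<integral>\<^sup>+ r. g k r \<partial>lborel) \<le> ennreal (integral {t k..t (Suc k)} (\<lambda>r. l (Z k r, a k)))" .
  qed auto
  finally show ?thesis .
qed

end

section \<open>Trajectories that approach the target\<close>

context restraint begin

lemma infdist_zero_imp_frontier:
  assumes "C \<noteq> {}" "x \<in> closure (- C)" "infdist x C = 0"
  shows "x \<in> frontier C"
  using in_closed_iff_infdist_zero[OF closed_C assms(1)] assms closed_C by (auto simp: frontier_closures)

lemma U_zero_on_frontier: "x \<in> frontier C \<Longrightarrow> U x = 0"
  using mrf unfolding minimum_restraint_function_with_def positive_definite_def by blast

lemma compact_sublevel: "compact {x \<in> closure (- C). U x \<in> {0..b}}"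
  using mrf unfolding minimum_restraint_function_with_def proper_fun_def by auto

text \<open>
  \<open>U\<close> and the distance from the target control each other, near the target as well as on bounded
  sets, and each of these bounds comes from compactness. Here, the points
  of a sublevel set at distance at least \<open>e\<close> form a compact set on which \<open>U\<close> has a positive minimum.
\<close>

lemma infdist_small_of_U_small:
  assumes "0 < e"
  shows "\<exists>d>0. \<forall>x\<in>- C. U x \<le> d \<longrightarrow> infdist x C \<le> e"
proof -
  define S where "S = {x \<in> closure (- C). U x \<in> {0..1}} \<inter> {x. e \<le> infdist x C}"
  have "closed {x. e \<le> infdist x C}"
    by (intro closed_Collect_le continuous_intros)
  then have S: "compact S" unfolding S_def using compact_sublevel by (intro compact_Int_closed)
  have pos: "0 < U x" if "x \<in> S" for x
  proof -
    have "x \<in> closure (- C)" "e \<le> infdist x C" using that by (auto simp: S_def)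
    moreover have "infdist x C = 0" if "x \<in> frontier C"
      using that closed_C by (auto simp: frontier_closures intro: infdist_zero)
    ultimately have "x \<in> - C" using closure_compl_cases[of x] assms by auto
    then show ?thesis by (rule U_pos)
  qed
  obtain m where m: "0 < m" "\<And>x. x \<in> S \<Longrightarrow> m \<le> U x"
  proof (cases "S = {}")
    case True then show ?thesis using that[of 1] by auto
  next
    case False
    have "continuous_on S U" by (rule continuous_on_subset[OF U_continuous]) (auto simp: S_def)
    then obtain x where "x \<in> S" "\<And>y. y \<in> S \<Longrightarrow> U x \<le> U y"
      using continuous_attains_inf[OF S False] by blast
    then show ?thesis using that pos by blast
  qed
  show ?thesis
  proof (intro exI[of _ "min 1 (m / 2)"] conjI ballI impI)
    fix x assume x: "x \<in> - C" "U x \<le> min 1 (m / 2)"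
    then have "x \<notin> S" using m by fastforce
    moreover have "0 \<le> U x" "x \<in> closure (- C)"
      using U_pos[OF x(1)] x(1) closure_subset[of "- C"] by auto
    ultimately show "infdist x C \<le> e" using x by (auto simp: S_def)
  qed (use m in auto)
qed

lemma infdist_bounded_on_sublevel: "\<exists>M. \<forall>x\<in>- C. U x \<le> b \<longrightarrow> infdist x C \<le> M"
proof -
  have "compact ((\<lambda>x. infdist x C) ` {x \<in> closure (- C). U x \<in> {0..b}})"
    by (intro compact_continuous_image compact_sublevel continuous_intros)
  from compact_imp_bounded[OF this] obtain M
    where M: "\<forall>v\<in>(\<lambda>x. infdist x C) ` {x \<in> closure (- C). U x \<in> {0..b}}. norm v \<le> M"
    unfolding bounded_iff by blast
  have "infdist x C \<le> M" if "x \<in> - C" "U x \<le> b" for x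
  proof -
    have "x \<in> {x \<in> closure (- C). U x \<in> {0..b}}" using that U_pos[of x] closure_subset[of "- C"] by auto
    then have "norm (infdist x C) \<le> M" using M by blast
    then show ?thesis by simp
  qed
  then show ?thesis by blast
qed

text \<open>
  A nearest point of \<open>C\<close> to a point outside \<open>C\<close> lies on the frontier, as otherwise the segment between them
  would meet the frontier earlier. Hence the tube is within distance \<open>r\<close> of a bounded set.
\<close>

lemma compact_tube:
  assumes "C \<noteq> {}"
  shows "compact {x \<in> closure (- C). infdist x C \<le> r}"
proof -
  obtain B where B: "\<And>y. y \<in> frontier C \<Longrightarrow> norm y \<le> B"
    using compact_imp_bounded[OF compact_frontier] unfolding bounded_iff by blast
  have "norm x \<le> B + r" if "x \<in> - C" "infdist x C \<le> r" for x
  proof -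
    obtain y where y: "y \<in> C" "infdist x C = dist x y"
      using infdist_attains_inf[OF closed_C assms] by blast
    have "y \<in> frontier C"
    proof (rule ccontr)
      assume "y \<notin> frontier C"
      then have "y \<in> interior C" using y closed_C by (auto simp: frontier_def)
      moreover have "closed_segment x y \<inter> frontier C \<noteq> {}"
        by (rule connected_Int_frontier) (use that y in auto)
      then obtain w where w: "w \<in> closed_segment x y" "w \<in> frontier C" by blast
      ultimately have "w \<noteq> y" using \<open>y \<notin> frontier C\<close> by auto
      have "w \<in> C" using w(2) closed_C by (auto simp: frontier_closures)
      then have "dist x y \<le> dist x w" using y(2) infdist_le by metis
      moreover have "dist x w + dist w y = dist x y"
        using w(1) between by (metis between_mem_segment)
      moreover have "0 < dist w y" using \<open>w \<noteq> y\<close> by simp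
      ultimately show False by linarith
    qed
    then have "norm x \<le> B + dist x y" using B norm_triangle_sub[of x y] by (fastforce simp: dist_norm)
    then show ?thesis using that y by simp
  qed
  then have "{x \<in> - C. infdist x C \<le> r} \<subseteq> cball 0 (B + r)" by auto
  moreover have "{x \<in> closure (- C). infdist x C \<le> r} \<subseteq> {x \<in> - C. infdist x C \<le> r} \<union> frontier C"
    using closure_compl_cases by auto
  ultimately have "bounded {x \<in> closure (- C). infdist x C \<le> r}"
    using compact_imp_bounded[OF compact_frontier] by (meson bounded_Un bounded_cball bounded_subset)
  moreover have "{x \<in> closure (- C). infdist x C \<le> r} = closure (- C) \<inter> {x. infdist x C \<le> r}" by auto
  moreover have "closed (closure (- C) \<inter> {x. infdist x C \<le> r})"
    by (intro closed_Int closed_Collect_le continuous_intros) auto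
  ultimately show ?thesis by (simp add: compact_eq_bounded_closed)
qed

lemma U_bounded_on_tube:
  assumes "C \<noteq> {}"
  shows "\<exists>b. \<forall>x\<in>- C. infdist x C \<le> r \<longrightarrow> U x \<le> b"
proof -
  have "compact (U ` {x \<in> closure (- C). infdist x C \<le> r})"
    by (intro compact_continuous_image compact_tube assms continuous_on_subset[OF U_continuous]) auto
  from compact_imp_bounded[OF this] obtain M
    where M: "\<forall>v\<in>U ` {x \<in> closure (- C). infdist x C \<le> r}. norm v \<le> M"
    unfolding bounded_iff by blast
  have "U x \<le> M" if "x \<in> - C" "infdist x C \<le> r" for x
  proof -
    have "x \<in> {x \<in> closure (- C). infdist x C \<le> r}" using that closure_subset[of "- C"] by auto
    then have "norm (U x) \<le> M" using M by blast
    then show ?thesis by simp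
  qed
  then show ?thesis by blast
qed

lemma U_small_near_target:
  assumes "C \<noteq> {}" "0 < e"
  shows "\<exists>d>0. \<forall>x\<in>- C. infdist x C \<le> d \<longrightarrow> U x \<le> e"
proof -
  define S where "S = {x \<in> closure (- C). infdist x C \<le> 1} \<inter> {x \<in> closure (- C). e \<le> U x}"
  have "closed {x \<in> closure (- C). e \<le> U x}"
    using continuous_closed_preimage[OF U_continuous closed_closure closed_atLeast[of e]]
    by (simp add: vimage_def Int_def)
  then have S: "compact S" unfolding S_def using compact_tube[OF assms(1)] by (intro compact_Int_closed)
  have pos: "0 < infdist x C" if "x \<in> S" for x
  proof -
    have "x \<in> closure (- C)" "e \<le> U x" using that by (auto simp: S_def)
    then have "infdist x C \<noteq> 0"
      using infdist_zero_imp_frontier[OF assms(1)] U_zero_on_frontier assms(2) by fastforce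
    then show ?thesis using infdist_nonneg[of x C] by linarith
  qed
  obtain m where m: "0 < m" "\<And>x. x \<in> S \<Longrightarrow> m \<le> infdist x C"
  proof (cases "S = {}")
    case True then show ?thesis using that[of 1] by auto
  next
    case False
    have "continuous_on S (\<lambda>x. infdist x C)" by (intro continuous_intros)
    then obtain x where "x \<in> S" "\<And>y. y \<in> S \<Longrightarrow> infdist x C \<le> infdist y C"
      using continuous_attains_inf[OF S False] by blast
    then show ?thesis using that pos by blast
  qed
  show ?thesis
  proof (intro exI[of _ "min 1 (m / 2)"] conjI ballI impI)
    fix x assume x: "x \<in> - C" "infdist x C \<le> min 1 (m / 2)"
    then have "x \<notin> S" using m by fastforce
    moreover have "x \<in> closure (- C)" using x(1) closure_subset[of "- C"] by auto
    ultimately show "U x \<le> e" using x by (auto simp: S_def)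
  qed (use m in auto)
qed

text \<open>
  The times \<open>\<Theta> a b\<close> do not depend on the initial point \<open>x\<close>: they make the convergence uniform, which is
  what a bound of class \<open>KL\<close> requires.
\<close>

definition descent_pair ::
  "(real \<Rightarrow> real \<Rightarrow> real) \<Rightarrow> real^'n \<Rightarrow> ereal \<Rightarrow> (real \<Rightarrow> real^'n) \<Rightarrow> (real \<Rightarrow> real^'m) \<Rightarrow> bool" where
  "descent_pair \<Theta> x T z \<alpha> \<longleftrightarrow> admissible C A f x T z \<alpha>
     \<and> (\<forall>t\<in>time_dom T. U (z t) \<le> U x)
     \<and> (\<forall>a b. \<forall>t\<in>time_dom T. 0 < a \<and> U x \<le> b \<and> \<Theta> a b < t \<longrightarrow> U (z t) \<le> a)
     \<and> ennreal p0 * (\<integral>\<^sup>+ t\<in>time_dom T. ennreal (l (z t, \<alpha> t)) \<partial>lborel) \<le> ennreal (U x)"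

text \<open>
  Follow descent arcs one after the other, each with length and rate \<open>\<Gamma>\<close> of the current level.
  While the level stays in \<open>[a, b]\<close> the rate is at least a constant \<open>\<gamma> a b > 0\<close>, so it has dropped to \<open>a\<close>
  by the time \<open>b / \<gamma> a b\<close>. As the arcs are then also of length at least \<open>\<gamma> a b\<close>, the number of arcs
  needed is finite, and the levels tend to \<open>0\<close> along the sequence of arcs even if their total
  duration is finite. Summing the decrease of \<open>U\<close> over all arcs bounds the total cost.
\<close>

lemma controlled_descent: "\<exists>\<Theta>. \<forall>x\<in>- C. \<exists>T z \<alpha>. descent_pair \<Theta> x T z \<alpha>"
proof -
  obtain \<Gamma> where \<Gamma>: "\<And>u. 0 < \<Gamma> u" and \<Gamma>_low: "\<And>a b. 0 < a \<Longrightarrow> \<exists>c>0. \<forall>u\<in>{a..b}. c \<le> \<Gamma> u"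
    and arcs: "\<And>x s. x \<in> - C \<Longrightarrow> \<exists>a z. descent_arc (\<Gamma> (U x)) x s a z"
    using descent_rate_exists by blast
  have "\<forall>a b. \<exists>c. 0 < a \<longrightarrow> 0 < c \<and> (\<forall>u\<in>{a..b}. c \<le> \<Gamma> u)" using \<Gamma>_low by blast
  then obtain \<gamma> where \<gamma>: "\<And>a b. 0 < a \<Longrightarrow> 0 < \<gamma> a b" "\<And>a b u. 0 < a \<Longrightarrow> u \<in> {a..b} \<Longrightarrow> \<gamma> a b \<le> \<Gamma> u"
    by metis
  have "\<forall>x s. \<exists>a z. x \<in> - C \<longrightarrow> descent_arc (\<Gamma> (U x)) x s a z" using arcs by blast
  then obtain ctl arc where arc: "\<And>x s. x \<in> - C \<Longrightarrow> descent_arc (\<Gamma> (U x)) x s (ctl x s) (arc x s)"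
    by metis
  have "\<exists>T z \<alpha>. descent_pair (\<lambda>a b. b / \<gamma> a b) x T z \<alpha>"
    if x: "x \<in> - C" for x
  proof -
    define next_state where "next_state = (\<lambda>(y, s). (arc y s (s + \<Gamma> (U y)), s + \<Gamma> (U y)))"
    define state where "state k = (next_state ^^ k) (x, 0)" for k :: nat
    define X where "X k = fst (state k)" for k
    define t where "t k = snd (state k)" for k
    define Z where "Z k = arc (X k) (t k)" for k
    define a where "a k = ctl (X k) (t k)" for k
    have X0: "X 0 = x" and t0: "t 0 = 0" by (simp_all add: X_def t_def state_def)
    have XS: "X (Suc k) = Z k (t (Suc k))" and tS: "t (Suc k) = t k + \<Gamma> (U (X k))" for k
      by (simp_all add: X_def t_def Z_def state_def next_state_def case_prod_beta)
    have XC: "X k \<in> - C" for k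
    proof (induction k)
      case 0 then show ?case using x X0 by simp
    next
      case (Suc k)
      have "t (Suc k) \<in> {t k..t k + \<Gamma> (U (X k))}" using tS \<Gamma>[of "U (X k)"] by simp
      then show ?case using arc[OF Suc, of "t k"] unfolding XS Z_def descent_arc_def by blast
    qed
    have arcs: "a k \<in> A" "Z k (t k) = X k"
      "\<And>r. r \<in> {t k..t (Suc k)} \<Longrightarrow> Z k r \<in> - C"
      "\<And>r. r \<in> {t k..t (Suc k)} \<Longrightarrow> (Z k has_vector_derivative f (Z k r, a k)) (at r within {t k..t (Suc k)})"
      "\<And>r. r \<in> {t k..t (Suc k)} \<Longrightarrow> U (Z k r) + p0 * integral {t k..r} (\<lambda>q. l (Z k q, a k)) \<le> U (X k) - \<Gamma> (U (X k)) * (r - t k)" for k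
      using arc[OF XC[of k], of "t k"] unfolding descent_arc_def a_def[symmetric] Z_def[symmetric] tS[symmetric]
      by blast+
    interpret concatenation t X Z a f C A
    proof
      show "strict_mono t" unfolding strict_mono_Suc_iff using tS \<Gamma> by (simp add: less_add_same_cancel1)
    qed (use t0 XS arcs cont_f in auto)
    \<comment> \<open>The integrand is continuous; the default value \<open>0\<close> of the integral spares a proof of integrability.\<close>
    have Jpos: "0 \<le> integral {t k..r} (\<lambda>q. l (Z k q, a k))" if "r \<le> t (Suc k)" for k r
    proof (cases "(\<lambda>q. l (Z k q, a k)) integrable_on {t k..r}")
      case True
      then show ?thesis
        using that arcs(1)[of k] arcs(3)[of _ k] by (intro integral_nonneg l_nonneg) auto
    qed (simp add: not_integrable_integral)
    have drop: "U (Z k r) \<le> U (X k) - \<Gamma> (U (X k)) * (r - t k)" if "r \<in> {t k..t (Suc k)}" for k r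
      using arcs(5)[OF that] mult_nonneg_nonneg[OF p0_nonneg Jpos[of r k]] that by auto
    have step: "U (X (Suc k)) + p0 * integral {t k..t (Suc k)} (\<lambda>q. l (Z k q, a k)) \<le> U (X k)" for k
    proof -
      have "0 \<le> \<Gamma> (U (X k)) * (t (Suc k) - t k)" using \<Gamma>[of "U (X k)"] tS[of k] by simp
      then show ?thesis using arcs(5)[of "t (Suc k)" k] t_less[of k] unfolding XS[symmetric] by auto
    qed
    have decr: "U (X j) \<le> U (X i)" if "i \<le> j" for i j
      using that
    proof (rule lift_Suc_antimono_le[rotated])
      fix k show "U (X (Suc k)) \<le> U (X k)"
        using step[of k] mult_nonneg_nonneg[OF p0_nonneg Jpos[of "t (Suc k)" k]] by linarith
    qed
    have below: "U (Z k r) \<le> U (X k)" if "r \<in> {t k..<t (Suc k)}" for k r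
    proof -
      have "0 \<le> \<Gamma> (U (X k)) * (r - t k)" using \<Gamma>[of "U (X k)"] that by (intro mult_nonneg_nonneg) auto
      then show ?thesis using drop[of r k] that by auto
    qed
    have rate: "U (X k) \<le> U x - c * t k" if c: "\<And>i. i < k \<Longrightarrow> c \<le> \<Gamma> (U (X i))" for k c
      using c
    proof (induction k)
      case (Suc k)
      have "c * (t (Suc k) - t k) \<le> \<Gamma> (U (X k)) * (t (Suc k) - t k)"
        using Suc.prems[of k] t_less[of k] by (intro mult_right_mono) auto
      moreover have "U (X (Suc k)) \<le> U (X k) - \<Gamma> (U (X k)) * (t (Suc k) - t k)"
        using drop[of "t (Suc k)" k] t_less[of k] unfolding XS[symmetric] by auto
      moreover have "U (X k) \<le> U x - c * t k" using Suc by auto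
      ultimately show ?case by (simp add: algebra_simps)
    qed (simp add: X0 t0)
    \<comment> \<open>As long as the level has not dropped below \<open>e\<close>, the decrease is at least linear.\<close>
    have high: "U (Z k r) \<le> U x - \<gamma> e b * r"
      if "0 < e" "U x \<le> b" "r \<in> {t k..<t (Suc k)}" "e \<le> U (X k)" for e b k r
    proof -
      have low: "\<gamma> e b \<le> \<Gamma> (U (X i))" if "i \<le> k" for i
        using decr[OF that] decr[of 0 i] X0 \<open>0 < e\<close> \<open>U x \<le> b\<close> \<open>e \<le> U (X k)\<close> by (intro \<gamma>(2)) auto
      have "U (X k) \<le> U x - \<gamma> e b * t k" using low by (intro rate) auto
      moreover have "\<gamma> e b * (r - t k) \<le> \<Gamma> (U (X k)) * (r - t k)"
        using low[of k] that by (intro mult_right_mono) auto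
      moreover have "U (Z k r) \<le> U (X k) - \<Gamma> (U (X k)) * (r - t k)" using drop that by auto
      ultimately show ?thesis by (simp add: algebra_simps)
    qed
    \<comment> \<open>After \<open>k\<close> arcs at levels above \<open>e\<close> the elapsed time is at least \<open>k * c\<close>, and the decrease at least
      \<open>k * c\<^sup>2\<close>, where \<open>c = \<gamma> e (U x)\<close>; this exceeds \<open>U x\<close> for large \<open>k\<close>.\<close>
    have X_small: "\<exists>N. U (X N) < e" if e: "0 < e" for e
    proof (rule ccontr)
      assume "\<nexists>N. U (X N) < e"
      then have ge: "e \<le> U (X k)" for k by (simp add: not_less)
      have low: "\<gamma> e (U x) \<le> \<Gamma> (U (X i))" for i
        using decr[of 0 i] X0 ge[of i] e by (intro \<gamma>(2)) auto
      let ?c = "\<gamma> e (U x)"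
      have c: "0 < ?c" using \<gamma>(1) e by blast
      have tk: "real k * ?c \<le> t k" for k
      proof (induction k)
        case (Suc k) then show ?case using tS[of k] low[of k] by (simp add: algebra_simps)
      qed (simp add: t0)
      obtain k :: nat where k: "U x / (?c * ?c) < k" using reals_Archimedean2 by blast
      have "U x < ?c * (real k * ?c)" using k c by (simp add: field_simps)
      also have "\<dots> \<le> ?c * t k" using tk c by (intro mult_left_mono) auto
      finally have "U (X k) < 0" using rate[of k ?c] low by simp
      then show False using ge[of k] e by simp
    qed
    have adm: "admissible C A f x T z \<alpha>"
      unfolding X0[symmetric]
    proof (rule z_admissible)
      fix e :: real assume "0 < e"
      then obtain d where d: "0 < d" "\<And>y. y \<in> - C \<Longrightarrow> U y \<le> d \<Longrightarrow> infdist y C \<le> e / 2"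
        using infdist_small_of_U_small[of "e / 2"] by (meson half_gt_zero)
      obtain N where N: "U (X N) < d" using X_small[OF d(1)] by blast
      show "\<exists>N. \<forall>k\<ge>N. \<forall>r\<in>{t k..<t (Suc k)}. infdist (Z k r) C < e"
      proof (intro exI[of _ N] allI impI ballI)
        fix k r assume "N \<le> k" and r: "r \<in> {t k..<t (Suc k)}"
        then have "U (Z k r) \<le> d" using below[OF r] decr[of N k] N by linarith
        moreover have "Z k r \<in> - C" using arcs(3) r by auto
        ultimately have "infdist (Z k r) C \<le> e / 2" using d by blast
        then show "infdist (Z k r) C < e" using \<open>0 < e\<close> by linarith
      qed
    qed
    have U_le: "U (z r) \<le> U x" if "r \<in> time_dom T" for r
    proof -
      obtain k where k: "r \<in> {t k..<t (Suc k)}" using \<open>r \<in> time_dom T\<close> unfolding time_dom_T by blast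
      then show ?thesis using below[OF k] decr[of 0 k] X0 z_eq[OF k] by simp
    qed
    have late: "U (z r) \<le> e" if r: "r \<in> time_dom T" and eb: "0 < e" "U x \<le> b" "b / \<gamma> e b < r" for e b r
    proof (rule ccontr)
      assume big: "\<not> U (z r) \<le> e"
      obtain k where k: "r \<in> {t k..<t (Suc k)}" using r unfolding time_dom_T by blast
      have "e \<le> U (X k)" using big below[OF k] z_eq[OF k] by simp
      then have "U (z r) \<le> U x - \<gamma> e b * r" using high[OF eb(1,2) k] z_eq[OF k] by simp
      moreover have "b < \<gamma> e b * r" using eb \<gamma>(1)[OF eb(1), of b] by (simp add: field_simps)
      ultimately show False using big eb by linarith
    qed
    define J where "J k = integral {t k..t (Suc k)} (\<lambda>q. l (Z k q, a k))" for k
    have J0: "0 \<le> J k" for k unfolding J_def using Jpos by simp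
    have "ennreal p0 * (\<integral>\<^sup>+ r\<in>time_dom T. ennreal (l (z r, \<alpha> r)) \<partial>lborel) \<le> ennreal p0 * (\<Sum>k. ennreal (J k))"
      unfolding J_def by (intro mult_left_mono z_cost_le cont_l l_nonneg) auto
    also have "\<dots> = (\<Sum>k. ennreal (p0 * J k))"
      using p0_nonneg J0 by (simp add: ennreal_mult)
    also have "\<dots> \<le> ennreal (U x)"
      unfolding suminf_eq_SUP
    proof (rule SUP_least)
      fix n
      have "(\<Sum>k<n. p0 * J k) \<le> U x - U (X n)"
      proof (induction n)
        case (Suc n) then show ?case using step[of n] by (simp add: J_def)
      qed (simp add: X0)
      then have "(\<Sum>k<n. p0 * J k) \<le> U x" using U_pos[OF XC[of n]] by linarith
      then show "(\<Sum>k<n. ennreal (p0 * J k)) \<le> ennreal (U x)"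
        using p0_nonneg J0 by (subst sum_ennreal) (auto intro: ennreal_leI)
    qed
    finally have "descent_pair (\<lambda>a b. b / \<gamma> a b) x T z \<alpha>"
      unfolding descent_pair_def using adm U_le late by blast
    then show ?thesis by blast
  qed
  then show ?thesis by blast
qed

lemma globally_asymptotically_controllable: "globally_asymptotically_controllable C A f"
proof -
  obtain \<Theta> where "\<forall>x\<in>- C. \<exists>T z \<alpha>. descent_pair \<Theta> x T z \<alpha>"
    using controlled_descent by blast
  then obtain T z \<alpha> where "\<And>x. x \<in> - C \<Longrightarrow> descent_pair \<Theta> x (T x) (z x) (\<alpha> x)"
    by metis
  then have adm: "\<And>x. x \<in> - C \<Longrightarrow> admissible C A f x (T x) (z x) (\<alpha> x)"
    and le: "\<And>x t. x \<in> - C \<Longrightarrow> t \<in> time_dom (T x) \<Longrightarrow> U (z x t) \<le> U x"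
    and late: "\<And>x a b t. x \<in> - C \<Longrightarrow> t \<in> time_dom (T x) \<Longrightarrow> 0 < a \<Longrightarrow> U x \<le> b \<Longrightarrow> \<Theta> a b < t
        \<Longrightarrow> U (z x t) \<le> a"
    unfolding descent_pair_def by blast+
  \<comment> \<open>The distance is set to \<open>0\<close> after a finite terminal time, in agreement with the prolongation by a
    boundary point.\<close>
  define g where "g x t = (if t \<in> time_dom (T x) then infdist (z x t) C else 0)" for x t
  have zC: "z x t \<in> - C" if "x \<in> - C" "t \<in> time_dom (T x)" for x t
    using adm[OF that(1)] that(2) unfolding admissible_def by blast
  have "\<exists>\<beta>. class_KL \<beta> \<and> (\<forall>x\<in>- C. \<forall>t\<ge>0. g x t \<le> \<beta> (infdist x C) t)"
  \<comment> \<open>For the empty target the distance is \<open>0\<close> by convention, and \<open>U\<close> is not bounded by it.\<close>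
  proof (cases "C = {}")
    case True
    then have "g x t = 0" for x t by (simp add: g_def infdist_def)
    then show ?thesis by (intro KL_majorant) (auto simp: infdist_nonneg intro: exI[of _ 1] exI[of _ 0])
  next
    case False
    show ?thesis
    proof (rule KL_majorant)
      show "0 \<le> infdist x C" "0 \<le> g x t" for x t by (simp_all add: g_def infdist_nonneg)
    next
      fix e :: real assume e: "0 < e"
      obtain d1 where d1: "0 < d1" "\<And>y. y \<in> - C \<Longrightarrow> U y \<le> d1 \<Longrightarrow> infdist y C \<le> e"
        using infdist_small_of_U_small[OF e] by blast
      obtain d where d: "0 < d" "\<And>y. y \<in> - C \<Longrightarrow> infdist y C \<le> d \<Longrightarrow> U y \<le> d1"
        using U_small_near_target[OF False d1(1)] by blast
      have "g x t \<le> e" if "x \<in> - C" "infdist x C \<le> d" for x t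
      proof (cases "t \<in> time_dom (T x)")
        case True
        from le[OF that(1) True] d(2)[OF that] have "U (z x t) \<le> d1" by linarith
        with d1(2)[OF zC[OF that(1) True]] True show ?thesis by (simp add: g_def)
      qed (use e in \<open>simp add: g_def\<close>)
      then show "\<exists>d>0. \<forall>x\<in>- C. infdist x C \<le> d \<longrightarrow> (\<forall>t\<ge>0. g x t \<le> e)" using d(1) by blast
    next
      fix r :: real
      obtain b where b: "\<And>y. y \<in> - C \<Longrightarrow> infdist y C \<le> r \<Longrightarrow> U y \<le> b"
        using U_bounded_on_tube[OF False] by blast
      obtain M where M: "\<And>y. y \<in> - C \<Longrightarrow> U y \<le> b \<Longrightarrow> infdist y C \<le> M"
        using infdist_bounded_on_sublevel by blast
      have "g x t \<le> max 0 M" if "x \<in> - C" "infdist x C \<le> r" for x t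
      proof (cases "t \<in> time_dom (T x)")
        case True
        from le[OF that(1) True] b[OF that] have "U (z x t) \<le> b" by linarith
        with M[OF zC[OF that(1) True]] True show ?thesis by (simp add: g_def le_max_iff_disj)
      qed (simp add: g_def)
      then show "\<exists>M. \<forall>x\<in>- C. infdist x C \<le> r \<longrightarrow> (\<forall>t\<ge>0. g x t \<le> M)" by blast
      fix e :: real assume e: "0 < e"
      obtain d1 where d1: "0 < d1" "\<And>y. y \<in> - C \<Longrightarrow> U y \<le> d1 \<Longrightarrow> infdist y C \<le> e"
        using infdist_small_of_U_small[OF e] by blast
      have "g x t \<le> e" if "x \<in> - C" "infdist x C \<le> r" "\<Theta> d1 b + 1 \<le> t" for x t
      proof (cases "t \<in> time_dom (T x)")
        case True
        from late[OF that(1) True d1(1) b[OF that(1,2)]] that(3) have "U (z x t) \<le> d1" by simp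
        with d1(2)[OF zC[OF that(1) True]] True show ?thesis by (simp add: g_def)
      qed (use e in \<open>simp add: g_def\<close>)
      then show "\<exists>T. \<forall>x\<in>- C. infdist x C \<le> r \<longrightarrow> (\<forall>t\<ge>0. T \<le> t \<longrightarrow> g x t \<le> e)" by blast
    qed
  qed
  then obtain \<beta> where \<beta>: "class_KL \<beta>" "\<And>x t. x \<in> - C \<Longrightarrow> 0 \<le> t \<Longrightarrow> g x t \<le> \<beta> (infdist x C) t"
    by blast
  have "infdist (prolong (T x) (z x) zbar t) C \<le> \<beta> (infdist x C) t"
    if x: "x \<in> - C" and zbar: "T x < \<infinity> \<longrightarrow> zbar \<in> frontier C" and t: "0 \<le> t" for x zbar t
  proof (cases "ereal t < T x")
    case True
    then show ?thesis using \<beta>(2)[OF x t] t by (simp add: prolong_def g_def time_dom_def)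
  next
    case False
    then have "T x < \<infinity>" by (metis ereal_infty_less(1) less_ereal.simps(4) not_less_iff_gr_or_eq)
    then have "zbar \<in> C" using zbar closed_C by (auto simp: frontier_closures)
    then show ?thesis using False \<beta>(2)[OF x t] by (simp add: prolong_def g_def time_dom_def)
  qed
  then show ?thesis
    unfolding globally_asymptotically_controllable_def using \<beta>(1) adm by blast
qed

lemma value_function_le:
  assumes p0: "0 < p0" and x: "x \<in> - C"
  shows "value_function C A f l x \<le> ennreal (U x / p0)"
proof -
  obtain T z \<alpha> where adm: "admissible C A f x T z \<alpha>"
    and cost: "ennreal p0 * (\<integral>\<^sup>+ t\<in>time_dom T. ennreal (l (z t, \<alpha> t)) \<partial>lborel) \<le> ennreal (U x)"
    using controlled_descent x unfolding descent_pair_def by blast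
  have "ennreal (U x) = ennreal p0 * ennreal (U x / p0)"
    using p0 U_pos[OF x] by (simp add: ennreal_mult[symmetric])
  with cost p0 have "(\<integral>\<^sup>+ t\<in>time_dom T. ennreal (l (z t, \<alpha> t)) \<partial>lborel) \<le> ennreal (U x / p0)"
    by (simp add: ennreal_mult_le_mult_iff)
  moreover have "value_function C A f l x \<le> (\<integral>\<^sup>+ t\<in>time_dom T. ennreal (l (z t, \<alpha> t)) \<partial>lborel)"
    unfolding value_function_def by (rule INF_lower2[of "(T, z, \<alpha>)"]) (use adm in auto)
  ultimately show ?thesis by (rule order_trans[rotated])
qed

end

section \<open>Controllability and the bound for the value function\<close>

theorem theorem1p1:
  fixes C :: "(real^'n) set" and A :: "(real^'m) set"
    and f :: "(real^'n) \<times> (real^'m) \<Rightarrow> real^'n"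
    and l :: "(real^'n) \<times> (real^'m) \<Rightarrow> real"
    and U :: "real^'n \<Rightarrow> real"
  assumes "compact A"
    and "closed C" and "compact (frontier C)"
    and "continuous_on ((- C) \<times> A) f"
    and "continuous_on ((- C) \<times> A) l"
    and "\<And>x a. x \<in> - C \<Longrightarrow> a \<in> A \<Longrightarrow> 0 \<le> l (x, a)"
    and "minimum_restraint_function C A f l U"
  shows "globally_asymptotically_controllable C A f
    \<and> (\<forall>p0>0. minimum_restraint_function_with C A f l p0 U \<longrightarrow>
         (\<forall>x\<in>- C. value_function C A f l x \<le> ennreal (U x / p0)))"
proof (intro conjI allI impI ballI)
  obtain q0 where "minimum_restraint_function_with C A f l q0 U"
    using assms(7) unfolding minimum_restraint_function_def by blast
  then interpret restraint C A f l U q0 using assms by unfold_locales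
  show "globally_asymptotically_controllable C A f"
    by (rule globally_asymptotically_controllable)
next
  fix p0 :: real and x
  assume "0 < p0" "minimum_restraint_function_with C A f l p0 U" "x \<in> - C"
  then interpret restraint C A f l U p0 using assms by unfold_locales
  show "value_function C A f l x \<le> ennreal (U x / p0)"
    using \<open>0 < p0\<close> \<open>x \<in> - C\<close> by (rule value_function_le)
qed

end
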